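(* For every $r\ge1$, let $W_r=(T_r)_{\mathbb R}$ be the underlying real representation of the finite multiqubit Clifford group $\widetilde{\mathrm{Cliff}}_r\le U(T_r)$, $T_r=(\mathbb C^2)^{\otimes r}$, defined in the context. Then $$\operatorname{End}_{\widetilde{\mathrm{Cliff}}_r}(W_r)=\mathbb C\qquad\text{and}\qquad \mathcal P_4(\widetilde{\mathrm{Cliff}}_r,W_r)=0.$$ In particular, $\dim_{\mathbb R}W_r=2^{r+1}\to\infty$ as $r\to\infty$, while $\dim_{\mathbb R}E_{\mathbb C}=3$; so the condition $\mathcal P_4=0$ occurs in an unbounded-dimensional family while the associated defect space $E_{\mathbb C}$ has fixed dimension three.
   Context: $\widetilde{\mathrm{Cliff}}_r\le U(T_r)$ is the finite group generated by the one-qubit gates $\mathsf H=\frac1{\sqrt2}\begin{pmatrix}1&1\\1&-1\end{pmatrix}$ and $S=\begin{pmatrix}1&0\\0&i\end{pmatrix}$ acting on each individual tensor factor of $T_r$ (trivially on the others), the controlled-NOT gates $\mathrm{CNOT}_{jk}|a,b\rangle=|a,a+b\ (\mathrm{mod}\ 2)\rangle$ acting on pairs $(j,k)$ of tensor factors, and the scalar $e^{\pi i/4}I$. For a finite group $G\le U(T)$, $T$ a finite-dimensional complex Hermitian space, with $W=T_{\mathbb R}$: $\operatorname{End}_G(W)$ is the algebra of real-linear endomorphisms of $W$ commuting with $G$, and $\operatorname{End}_G(W)=\mathbb C$ means that it consists exactly of the complex scalars. In this situation put $V=W\oplus W$ with diagonal $G$-action, and for $x=(x_1,x_2)\in V$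 let $H(x)=(\langle x_i,x_j\rangle)_{i,j}$ be the $2\times2$ Hermitian Gram matrix ($\langle\cdot,\cdot\rangle$ the Hermitian form of $T$, conjugate-linear in the first variable). For $B\in\operatorname{Herm}_2(\mathbb C)$ let $\gamma_B(x)=\operatorname{Re}\operatorname{tr}(BH(x))$, a real quadratic form on the real vector space $V$. Let $\mathcal G_4(G,W)$ be the span of all products $\gamma_B\gamma_C$, $B,C\in\operatorname{Herm}_2(\mathbb C)$, inside the space $\operatorname{Sym}^4(V^* )^G$ of real $G$-invariant homogeneous quartic polynomials on $V$, and $\mathcal P_4(G,W)=\operatorname{Sym}^4(V^* )^G/\mathcal G_4(G,W)$. $E_{\mathbb C}$ is the real space of traceless matrices in $\operatorname{Herm}_2(\mathbb C)$. *)

theory Defs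
  imports
    "HOL-Analysis.Analysis"
    "HOL-Algebra.Bij"
    "HOL-Algebra.Generated_Groups"
    "HOL-Library.Function_Algebras"
    "HOL-Library.Z2"
begin

section \<open>Functions as real vectors\<close>

instantiation "fun" :: (type, real_vector) real_vector
begin

definition scaleR_fun :: "real \<Rightarrow> ('a \<Rightarrow> 'b) \<Rightarrow> 'a \<Rightarrow> 'b"
  where "scaleR_fun c f = (\<lambda>x. c *\<^sub>R f x)"

instance
  by standard (simp_all add: scaleR_fun_def fun_eq_iff scaleR_add_right scaleR_add_left)

end

definition real_linear_on :: "'a::real_vector set \<Rightarrow> ('a \<Rightarrow> 'b::real_vector) \<Rightarrow> bool"
  where "real_linear_on S f \<longleftrightarrow>
    (\<forall>x\<in>S. \<forall>y\<in>S. f (x + y) = f x + f y) \<and> (\<forall>c. \<forall>x\<in>S. f (c *\<^sub>R x) = c *\<^sub>R f x)"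

section \<open>The Hermitian space with a finite orthonormal basis \<open>I\<close>\<close>

text \<open>
  A vector is the family of its coordinates. Keeping all of them in one type (with zero
  coordinates outside \<open>I\<close>) lets \<open>I\<close>, and hence the dimension, vary inside a
  statement. The underlying real space \<open>W\<close> has the same carrier, regarded as a subspace of
  the real vector space \<^typ>\<open>'i \<Rightarrow> complex\<close>.
\<close>

definition hspace :: "'i set \<Rightarrow> ('i \<Rightarrow> complex) set"
  where "hspace I = {x. \<forall>a. a \<notin> I \<longrightarrow> x a = 0}"

definition cscale :: "complex \<Rightarrow> ('i \<Rightarrow> complex) \<Rightarrow> 'i \<Rightarrow> complex"
  where "cscale c x = (\<lambda>a. c * x a)"

definition herm :: "'i set \<Rightarrow> ('i \<Rightarrow> complex) \<Rightarrow> ('i \<Rightarrow> complex) \<Rightarrow> complex"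
  where "herm I x y = (\<Sum>a\<in>I. cnj (x a) * y a)"

text \<open>
  Endomorphisms of a carrier are extensional functions (undefined off the carrier), as in
  \<^const>\<open>BijGroup\<close>, so that equality of functions is equality of endomorphisms.
\<close>

definition unitary_group :: "'i set \<Rightarrow> (('i \<Rightarrow> complex) \<Rightarrow> 'i \<Rightarrow> complex) monoid"
  where "unitary_group I = BijGroup (hspace I)
    \<lparr>carrier := {U \<in> Bij (hspace I).
       (\<forall>x\<in>hspace I. \<forall>y\<in>hspace I. U (x + y) = U x + U y) \<and>
       (\<forall>c. \<forall>x\<in>hspace I. U (cscale c x) = cscale c (U x)) \<and>
       (\<forall>x\<in>hspace I. \<forall>y\<in>hspace I. herm I (U x) (U y) = herm I x y)}\<rparr>"

definition matrix_op ::
    "'i set \<Rightarrow> ('i \<Rightarrow> 'i \<Rightarrow> complex) \<Rightarrow> ('i \<Rightarrow> complex) \<Rightarrow> 'i \<Rightarrow> complex"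
  where "matrix_op I M =
    (\<lambda>x\<in>hspace I. \<lambda>a. if a \<in> I then \<Sum>b\<in>I. M a b * x b else 0)"

section \<open>Real endomorphisms and quartic invariants of a group of operators\<close>

definition End_G ::
    "'i set \<Rightarrow> (('i \<Rightarrow> complex) \<Rightarrow> 'i \<Rightarrow> complex) set \<Rightarrow> (('i \<Rightarrow> complex) \<Rightarrow> 'i \<Rightarrow> complex) set"
  where "End_G I G = {A \<in> hspace I \<rightarrow>\<^sub>E hspace I.
    real_linear_on (hspace I) A \<and> (\<forall>g\<in>G. \<forall>x\<in>hspace I. A (g x) = g (A x))}"

definition complex_scalars :: "'i set \<Rightarrow> (('i \<Rightarrow> complex) \<Rightarrow> 'i \<Rightarrow> complex) set"
  where "complex_scalars I = range (\<lambda>c. \<lambda>x\<in>hspace I. cscale c x)"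

type_synonym 'i pairvec = "('i \<Rightarrow> complex) \<times> ('i \<Rightarrow> complex)"

definition V_space :: "'i set \<Rightarrow> 'i pairvec set"
  where "V_space I = hspace I \<times> hspace I"

text \<open>
  Real functions on \<open>V\<close> are extended by \<open>0\<close>, so they form a subspace of the
  function space. As the field is infinite, homogeneous quartic polynomials on \<open>V\<close> may be
  identified with the functions they define: sums of products of four linear functionals.
\<close>

definition V_dual :: "'i set \<Rightarrow> ('i pairvec \<Rightarrow> real) set"
  where "V_dual I = {f. real_linear_on (V_space I) f \<and> (\<forall>x. x \<notin> V_space I \<longrightarrow> f x = 0)}"

definition Sym4 :: "'i set \<Rightarrow> ('i pairvec \<Rightarrow> real) set"
  where "Sym4 I = span {f1 * f2 * f3 * f4 | f1 f2 f3 f4.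
    f1 \<in> V_dual I \<and> f2 \<in> V_dual I \<and> f3 \<in> V_dual I \<and> f4 \<in> V_dual I}"

definition Sym4_inv ::
    "'i set \<Rightarrow> (('i \<Rightarrow> complex) \<Rightarrow> 'i \<Rightarrow> complex) set \<Rightarrow> ('i pairvec \<Rightarrow> real) set"
  where "Sym4_inv I G = {f \<in> Sym4 I. \<forall>g\<in>G. \<forall>x\<in>V_space I. f (map_prod g g x) = f x}"

definition Herm2 :: "(complex^2^2) set"
  where "Herm2 = {B. \<forall>i j. B $ i $ j = cnj (B $ j $ i)}"

definition E_C :: "(complex^2^2) set"
  where "E_C = {B \<in> Herm2. trace B = 0}"

definition component :: "'i pairvec \<Rightarrow> 2 \<Rightarrow> 'i \<Rightarrow> complex"
  where "component x i = (if i = 1 then fst x else snd x)"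

definition gram :: "'i set \<Rightarrow> 'i pairvec \<Rightarrow> complex^2^2"
  where "gram I x = (\<chi> i j. herm I (component x i) (component x j))"

definition gamma :: "'i set \<Rightarrow> complex^2^2 \<Rightarrow> 'i pairvec \<Rightarrow> real"
  where "gamma I B = (\<lambda>x. if x \<in> V_space I then Re (trace (B ** gram I x)) else 0)"

definition G4 :: "'i set \<Rightarrow> ('i pairvec \<Rightarrow> real) set"
  where "G4 I = span {gamma I B * gamma I C | B C. B \<in> Herm2 \<and> C \<in> Herm2}"

text \<open>The quotient space as its set of cosets; its zero is the coset \<^term>\<open>G4 I\<close>.\<close>

definition P4 ::
    "'i set \<Rightarrow> (('i \<Rightarrow> complex) \<Rightarrow> 'i \<Rightarrow> complex) set \<Rightarrow> ('i pairvec \<Rightarrow> real) set set"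
  where "P4 I G =
    Sym4_inv I G // {(f, h). f \<in> Sym4_inv I G \<and> h \<in> Sym4_inv I G \<and> f - h \<in> G4 I}"

section \<open>The multiqubit Clifford group\<close>

text \<open>
  The computational basis of the \<open>r\<close>-fold tensor power of the qubit space is indexed by the
  bit strings of length \<open>r\<close>, written as functions on the tensor factors \<open>k < r\<close>
  (and padded by \<open>0\<close>). Addition in \<^typ>\<open>bit\<close> is modulo 2.
\<close>

definition bits :: "nat \<Rightarrow> (nat \<Rightarrow> bit) set"
  where "bits r = {a. \<forall>k\<ge>r. a k = 0}"

definition H_gate :: "bit \<Rightarrow> bit \<Rightarrow> complex"
  where "H_gate p q = (if p = 1 \<and> q = 1 then -1 else 1) / complex_of_real (sqrt 2)"

definition S_gate :: "bit \<Rightarrow> bit \<Rightarrow> complex"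
  where "S_gate p q = (if p = q then if p = 1 then \<i> else 1 else 0)"

definition on_qubit ::
    "nat \<Rightarrow> (bit \<Rightarrow> bit \<Rightarrow> complex) \<Rightarrow> (nat \<Rightarrow> bit) \<Rightarrow> (nat \<Rightarrow> bit) \<Rightarrow> complex"
  where "on_qubit k A a b = (if \<forall>j. j \<noteq> k \<longrightarrow> a j = b j then A (a k) (b k) else 0)"

definition CNOT :: "nat \<Rightarrow> nat \<Rightarrow> (nat \<Rightarrow> bit) \<Rightarrow> (nat \<Rightarrow> bit) \<Rightarrow> complex"
  where "CNOT j k a b = (if a = b(k := b j + b k) then 1 else 0)"

definition clifford_gates :: "nat \<Rightarrow> (((nat \<Rightarrow> bit) \<Rightarrow> complex) \<Rightarrow> (nat \<Rightarrow> bit) \<Rightarrow> complex) set"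
  where "clifford_gates r =
    {matrix_op (bits r) (on_qubit k H_gate) | k. k < r} \<union>
    {matrix_op (bits r) (on_qubit k S_gate) | k. k < r} \<union>
    {matrix_op (bits r) (CNOT j k) | j k. j < r \<and> k < r \<and> j \<noteq> k} \<union>
    {\<lambda>x\<in>hspace (bits r). cscale (exp (of_real pi * \<i> / 4)) x}"

definition Cliff :: "nat \<Rightarrow> (((nat \<Rightarrow> bit) \<Rightarrow> complex) \<Rightarrow> (nat \<Rightarrow> bit) \<Rightarrow> complex) set"
  where "Cliff r = generate (unitary_group (bits r)) (clifford_gates r)"

end

theory Submission
  imports Defs
begin

text \<open>
  An invariant quartic is a combination of words of length four in the coordinates and their
  conjugates. Invariance under the diagonal Clifford elements (the scalar, the phase gates and their
  CNOT conjugates) keeps only the words \<open>x\<^sub>i(a) x\<^sub>j(b)\<close> times the conjugate of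
  \<open>x\<^sub>k(a) x\<^sub>l(b)\<close>, so the quartic is a sum over pairs of basis states \<open>a, b\<close> of biquadratic forms
  in the values of \<open>x\<close> at \<open>a\<close> and \<open>b\<close>. The Pauli \<open>X\<close> and CNOT gates permute the basis states
  two-transitively, so these forms depend only on whether \<open>a = b\<close>. Hence the quartic is a
  polynomial in the Gram matrix plus a sum over single basis states of a homogeneous form \<open>u\<close>. Both
  parts are invariant under a Hadamard gate, and evaluating at a vector supported at a single basis
  state gives \<open>u(v) = 2 u(v / sqrt 2) = u(v) / 2\<close>, so \<open>u = 0\<close>.

  For the commutant, the square of the scalar gate makes an endomorphism complex linear, the phase
  gates make it diagonal, and transitivity on the basis states makes the diagonal constant.
\<close>

section \<open>Bit strings\<close>

text \<open>Ordered words represent one monomial several times, so an expansion into words is not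
  determined by the polynomial. The proof therefore compares functions, never coefficients:
  averaging replaces the comparison of weights, and evaluation at vectors supported on two basis
  states replaces the comparison of biquadratic coefficients. Such an evaluation recovers only the
  sum of the two orders of a pair \<open>a\<close>, \<open>b\<close>, which is why the identity with
  the Gram matrix is obtained for twice the quartic. The single-qubit phases alone are too weak:
  they match plain with conjugated indices separately at each qubit, so the matching could be
  straight at one qubit and crossed at another. The parity phases exclude such mixtures. All
  generators except the Hadamard gates are monomial matrices, and these preserve every sum over
  basis states of a form like \<open>u\<close>, which is unchanged by phases. Hence only a Hadamard
  gate can remove \<open>u\<close>.\<close>

definition flip :: "nat \<Rightarrow> (nat \<Rightarrow> bit) \<Rightarrow> nat \<Rightarrow> bit"
  where "flip k a = a(k := a k + 1)"

lemma flip_flip [simp]: "flip k (flip k a) = a"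
  by (cases "a k") (auto simp: flip_def)

lemma flip_same [simp]: "flip k a k = a k + 1"
  by (simp add: flip_def)

lemma flip_neq [simp]: "flip k a \<noteq> a" "a \<noteq> flip k a"
  by (auto simp: flip_def fun_eq_iff)

lemma flip_in_bits [simp]: "k < r \<Longrightarrow> flip k a \<in> bits r \<longleftrightarrow> a \<in> bits r"
  by (auto simp: flip_def bits_def)

lemma bits_Suc: "bits (Suc r) = bits r \<union> flip r ` bits r"
proof (intro equalityI subsetI)
  fix a assume a: "a \<in> bits (Suc r)"
  show "a \<in> bits r \<union> flip r ` bits r"
  proof (cases "a r = 0")
    case True
    with a have "a \<in> bits r" by (auto simp: bits_def) (metis Suc_leI le_neq_implies_less)
    then show ?thesis by simp
  next
    case False
    with a have "flip r a \<in> bits r" by (auto simp: bits_def flip_def)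
    then have "flip r (flip r a) \<in> flip r ` bits r" by blast
    then show ?thesis by simp
  qed
qed (auto simp: bits_def flip_def)

lemma finite_bits [simp]: "finite (bits r)"
  and card_bits: "card (bits r) = 2 ^ r"
proof (induction r)
  case 0
  have "bits 0 = {\<lambda>_. 0}" by (auto simp: bits_def)
  then show "finite (bits 0)" "card (bits 0) = 2 ^ 0" by simp_all
next
  case (Suc r)
  show "finite (bits (Suc r))" using Suc.IH by (simp add: bits_Suc)
  have "inj_on (flip r) (bits r)" by (rule inj_on_inverseI[of _ "flip r"]) simp
  moreover have "bits r \<inter> flip r ` bits r = {}"
    by (auto simp: bits_def flip_def)
  ultimately show "card (bits (Suc r)) = 2 ^ Suc r"
    using Suc.IH by (simp add: bits_Suc card_Un_disjoint card_image)
qed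

lemma zero_in_bits [simp]: "(\<lambda>_. 0) \<in> bits r"
  by (simp add: bits_def)

lemma hspace_add [simp]: "x \<in> hspace I \<Longrightarrow> y \<in> hspace I \<Longrightarrow> x + y \<in> hspace I"
  and hspace_cscale [simp]: "x \<in> hspace I \<Longrightarrow> cscale c x \<in> hspace I"
  and hspace_scaleR [simp]: "x \<in> hspace I \<Longrightarrow> t *\<^sub>R x \<in> hspace I"
  and hspace_zero [simp]: "0 \<in> hspace I"
  by (simp_all add: hspace_def cscale_def scaleR_fun_def)

lemma hspace_mult [simp]: "x \<in> hspace I \<Longrightarrow> (\<lambda>a. c * x a) \<in> hspace I"
  by (simp add: hspace_def)

lemma hspaceD: "x \<in> hspace I \<Longrightarrow> a \<notin> I \<Longrightarrow> x a = 0"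
  by (simp add: hspace_def)

section \<open>Permutation, diagonal and Hadamard operators\<close>

text \<open>Acts by pull-back, so composition of operators reverses the order of the index maps.
  There is no cut-off at \<open>I\<close>: the result lies in \<open>hspace I\<close> when
  \<open>p\<close> preserves membership in \<open>I\<close>.\<close>

definition perm_op :: "'i set \<Rightarrow> ('i \<Rightarrow> 'i) \<Rightarrow> ('i \<Rightarrow> complex) \<Rightarrow> 'i \<Rightarrow> complex"
  where "perm_op I p = (\<lambda>x\<in>hspace I. \<lambda>a. x (p a))"

definition diag_op :: "'i set \<Rightarrow> ('i \<Rightarrow> complex) \<Rightarrow> ('i \<Rightarrow> complex) \<Rightarrow> 'i \<Rightarrow> complex"
  where "diag_op I d = (\<lambda>x\<in>hspace I. \<lambda>a. d a * x a)"

definition had_op :: "nat \<Rightarrow> nat \<Rightarrow> ((nat \<Rightarrow> bit) \<Rightarrow> complex) \<Rightarrow> (nat \<Rightarrow> bit) \<Rightarrow> complex"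
  where "had_op r k = (\<lambda>x\<in>hspace (bits r). \<lambda>a.
    ((if a k = 1 then -1 else 1) * x a + x (flip k a)) / complex_of_real (sqrt 2))"

text \<open>Row \<open>a\<close> of the matrix is supported on \<open>a\<close> and
  \<open>flip k a\<close>. For \<open>a\<close> outside \<open>bits r\<close> both coordinates of
  \<open>x\<close> vanish, as \<open>k < r\<close>, so the formula holds at every index.\<close>

lemma on_qubit_op:
  assumes k: "k < r" and x: "x \<in> hspace (bits r)"
  shows "matrix_op (bits r) (on_qubit k A) x a =
    A (a k) (a k) * x a + A (a k) (a k + 1) * x (flip k a)"
proof (cases "a \<in> bits r")
  case True
  have "(\<Sum>b\<in>bits r. on_qubit k A a b * x b) = (\<Sum>b\<in>{a, flip k a}. on_qubit k A a b * x b)"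
  proof (rule sum.mono_neutral_right)
    show "\<forall>b\<in>bits r - {a, flip k a}. on_qubit k A a b * x b = 0"
    proof
      fix b assume b: "b \<in> bits r - {a, flip k a}"
      have "\<not> (\<forall>j. j \<noteq> k \<longrightarrow> a j = b j)"
      proof
        assume eq: "\<forall>j. j \<noteq> k \<longrightarrow> a j = b j"
        consider "b k = a k" | "b k = a k + 1" by (cases "a k"; cases "b k") auto
        then show False
        proof cases
          case 1
          with eq have "b = a" by (intro ext) metis
          with b show False by simp
        next
          case 2
          with eq have "b j = flip k a j" for j by (cases "j = k") (simp_all add: flip_def)
          then have "b = flip k a" by blast
          with b show False by simp
        qed
      qed
      then have "on_qubit k A a b = 0" unfolding on_qubit_def by (rule if_not_P)
      then show "on_qubit k A a b * x b = 0" by simp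
    qed
  qed (use k True in auto)
  also have "\<dots> = A (a k) (a k) * x a + A (a k) (a k + 1) * x (flip k a)"
  proof -
    have eq: "\<forall>j. j \<noteq> k \<longrightarrow> a j = flip k a j"
      by (simp add: flip_def)
    have "on_qubit k A a a = A (a k) (a k)" "on_qubit k A a (flip k a) = A (a k) (a k + 1)"
      using eq unfolding on_qubit_def by (simp, simp only: if_P flip_same)
    then show ?thesis by simp
  qed
  finally show ?thesis using x True by (simp add: matrix_op_def)
next
  case False
  then show ?thesis using k x by (simp add: matrix_op_def hspaceD[OF x])
qed

lemma had_op_eq: "k < r \<Longrightarrow> matrix_op (bits r) (on_qubit k H_gate) = had_op r k"
proof (rule extensionalityI[of _ "hspace (bits r)"])
  fix x assume k: "k < r" and x: "x \<in> hspace (bits r)"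
  show "matrix_op (bits r) (on_qubit k H_gate) x = had_op r k x"
  proof
    fix a
    show "matrix_op (bits r) (on_qubit k H_gate) x a = had_op r k x a"
      by (cases "a k") (simp_all add: on_qubit_op[OF k x] had_op_def x H_gate_def add_divide_distrib)
  qed
qed (auto simp: matrix_op_def had_op_def)

lemma S_op_eq: "k < r \<Longrightarrow>
  matrix_op (bits r) (on_qubit k S_gate) = diag_op (bits r) (\<lambda>a. if a k = 1 then \<i> else 1)"
proof (rule extensionalityI[of _ "hspace (bits r)"])
  fix x assume k: "k < r" and x: "x \<in> hspace (bits r)"
  show "matrix_op (bits r) (on_qubit k S_gate) x = diag_op (bits r) (\<lambda>a. if a k = 1 then \<i> else 1) x"
  proof
    fix a
    show "matrix_op (bits r) (on_qubit k S_gate) x a = diag_op (bits r) (\<lambda>a. if a k = 1 then \<i> else 1) x a"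
      by (cases "a k") (simp_all add: on_qubit_op[OF k x] diag_op_def x S_gate_def)
  qed
qed (auto simp: matrix_op_def diag_op_def)

definition cadd :: "nat \<Rightarrow> nat \<Rightarrow> (nat \<Rightarrow> bit) \<Rightarrow> nat \<Rightarrow> bit"
  where "cadd j k a = a(k := a j + a k)"

lemma cadd_cadd [simp]: "j \<noteq> k \<Longrightarrow> cadd j k (cadd j k a) = a"
  by (cases "a j"; cases "a k") (auto simp: cadd_def)

lemma cadd_in_bits [simp]: "j < r \<Longrightarrow> k < r \<Longrightarrow> cadd j k a \<in> bits r \<longleftrightarrow> a \<in> bits r"
  by (auto simp: cadd_def bits_def)

text \<open>\<open>CNOT\<close> pushes basis states forward and \<open>perm_op\<close> pulls back;
  the two agree because \<open>cadd j k\<close> is an involution.\<close>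

lemma CNOT_op_eq:
  assumes jk: "j < r" "k < r" "j \<noteq> k"
  shows "matrix_op (bits r) (CNOT j k) = perm_op (bits r) (cadd j k)"
proof (rule extensionalityI[of _ "hspace (bits r)"])
  fix x assume x: "x \<in> hspace (bits r)"
  show "matrix_op (bits r) (CNOT j k) x = perm_op (bits r) (cadd j k) x"
  proof
    fix a
    have C: "CNOT j k a b = (if b = cadd j k a then 1 else 0)" for b
    proof -
      have "a = b(k := b j + b k) \<longleftrightarrow> b = cadd j k a"
        using cadd_cadd[OF jk(3)] unfolding cadd_def by metis
      then show ?thesis by (simp add: CNOT_def)
    qed
    show "matrix_op (bits r) (CNOT j k) x a = perm_op (bits r) (cadd j k) x a"
      using jk x by (auto simp: matrix_op_def perm_op_def C if_distrib[of "\<lambda>c. c * _"] hspaceD[OF x] cong: if_cong)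
  qed
qed (auto simp: matrix_op_def perm_op_def)

abbreviation omega :: complex
  where "omega \<equiv> exp (of_real pi * \<i> / 4)"

lemma clifford_gates_eq: "clifford_gates r =
    {had_op r k | k. k < r} \<union>
    {diag_op (bits r) (\<lambda>a. if a k = 1 then \<i> else 1) | k. k < r} \<union>
    {perm_op (bits r) (cadd j k) | j k. j < r \<and> k < r \<and> j \<noteq> k} \<union>
    {diag_op (bits r) (\<lambda>_. omega)}"
proof -
  have 1: "{matrix_op (bits r) (on_qubit k H_gate) | k. k < r} = {had_op r k | k. k < r}"
    by (simp add: had_op_eq cong: rev_conj_cong)
  have 2: "{matrix_op (bits r) (on_qubit k S_gate) | k. k < r} =
      {diag_op (bits r) (\<lambda>a. if a k = 1 then \<i> else 1) | k. k < r}"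
    by (simp add: S_op_eq cong: rev_conj_cong)
  have 3: "{matrix_op (bits r) (CNOT j k) | j k. j < r \<and> k < r \<and> j \<noteq> k} =
      {perm_op (bits r) (cadd j k) | j k. j < r \<and> k < r \<and> j \<noteq> k}"
    by (simp add: CNOT_op_eq cong: rev_conj_cong)
  have 4: "cscale omega = (\<lambda>x a. omega * x a)"
    by (rule ext)+ (simp only: cscale_def)
  show ?thesis
    unfolding clifford_gates_def 1 2 3 by (simp only: diag_op_def 4)
qed

section \<open>The Clifford group inside the unitary group\<close>

text \<open>Bijectivity is supplied by an explicit two-sided inverse \<open>V\<close>; each gate
  below comes with one.\<close>

lemma unitaryI:
  assumes "U \<in> extensional (hspace I)"
    and "\<And>x. x \<in> hspace I \<Longrightarrow> U x \<in> hspace I" "\<And>x. x \<in> hspace I \<Longrightarrow> V x \<in> hspace I"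
    and "\<And>x. x \<in> hspace I \<Longrightarrow> U (V x) = x" "\<And>x. x \<in> hspace I \<Longrightarrow> V (U x) = x"
    and "\<And>x y. x \<in> hspace I \<Longrightarrow> y \<in> hspace I \<Longrightarrow> U (x + y) = U x + U y"
    and "\<And>c x. x \<in> hspace I \<Longrightarrow> U (cscale c x) = cscale c (U x)"
    and "\<And>x y. x \<in> hspace I \<Longrightarrow> y \<in> hspace I \<Longrightarrow> herm I (U x) (U y) = herm I x y"
  shows "U \<in> carrier (unitary_group I)"
proof -
  have "bij_betw U (hspace I) (hspace I)"
    by (rule bij_betw_byWitness[of _ V]) (use assms in auto)
  then show ?thesis
    using assms by (simp add: unitary_group_def Bij_def)
qed

lemma diag_op_unitary:
  assumes d: "\<And>a. cmod (d a) = 1"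
  shows "diag_op I d \<in> carrier (unitary_group I)"
proof (rule unitaryI[of _ _ "diag_op I (\<lambda>a. cnj (d a))"])
  have c: "cnj (d a) * d a = 1" "d a * cnj (d a) = 1" for a
    using d[of a] complex_norm_square[of "d a"] by (simp_all add: mult.commute[of "cnj _"])
  have hs: "diag_op I e x \<in> hspace I" if "x \<in> hspace I" for e x
    using that by (simp add: diag_op_def hspace_def)
  show "diag_op I d x \<in> hspace I" "diag_op I (\<lambda>a. cnj (d a)) x \<in> hspace I" if "x \<in> hspace I" for x
    using hs that by auto
  show "diag_op I d (diag_op I (\<lambda>a. cnj (d a)) x) = x"
    "diag_op I (\<lambda>a. cnj (d a)) (diag_op I d x) = x" if "x \<in> hspace I" for x
    using hs[OF that] that c by (auto simp: diag_op_def fun_eq_iff simp flip: mult.assoc)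
  show "herm I (diag_op I d x) (diag_op I d y) = herm I x y"
    if "x \<in> hspace I" "y \<in> hspace I" for x y
  proof -
    have "cnj (d a * x a) * (d a * y a) = (cnj (d a) * d a) * (cnj (x a) * y a)" for a
      by (simp add: mult_ac)
    then show ?thesis using that by (simp only: herm_def diag_op_def restrict_apply' c mult_1)
  qed
qed (auto simp: diag_op_def cscale_def fun_eq_iff algebra_simps)

lemma perm_op_unitary:
  assumes "\<And>a. q (p a) = a" "\<And>a. p (q a) = a" "\<And>a. p a \<in> I \<longleftrightarrow> a \<in> I"
  shows "perm_op I p \<in> carrier (unitary_group I)"
proof (rule unitaryI[of _ _ "perm_op I q"])
  have q: "q a \<in> I \<longleftrightarrow> a \<in> I" for a
    using assms by metis
  have hs: "perm_op I p x \<in> hspace I" "perm_op I q x \<in> hspace I" if "x \<in> hspace I" for x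
    using that assms(3) q by (auto simp: perm_op_def hspace_def)
  show "perm_op I p x \<in> hspace I" "perm_op I q x \<in> hspace I" if "x \<in> hspace I" for x
    using hs that by auto
  show "perm_op I p (perm_op I q x) = x" "perm_op I q (perm_op I p x) = x" if "x \<in> hspace I" for x
    using hs[OF that] that assms by (auto simp: perm_op_def fun_eq_iff)
  show "herm I (perm_op I p x) (perm_op I p y) = herm I x y"
    if "x \<in> hspace I" "y \<in> hspace I" for x y
  proof -
    have "bij_betw p I I"
      by (rule bij_betw_byWitness[of _ q]) (use assms q in auto)
    then have "(\<Sum>a\<in>I. cnj (x (p a)) * y (p a)) = (\<Sum>a\<in>I. cnj (x a) * y a)"
      by (rule sum.reindex_bij_betw)
    then show ?thesis using that by (simp add: herm_def perm_op_def)
  qed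
qed (auto simp: perm_op_def cscale_def fun_eq_iff)

lemma of_real_sqrt2_sq: "complex_of_real (sqrt 2) * complex_of_real (sqrt 2) = 2"
  by (simp flip: of_real_mult)

lemma had_op_in_hspace [simp]: "k < r \<Longrightarrow> x \<in> hspace (bits r) \<Longrightarrow> had_op r k x \<in> hspace (bits r)"
  by (simp add: had_op_def hspace_def)

lemma had_op_apply: "x \<in> hspace (bits r) \<Longrightarrow>
    had_op r k x a = ((if a k = 1 then -1 else 1) * x a + x (flip k a)) / complex_of_real (sqrt 2)"
  by (simp add: had_op_def)

lemma had_op_add: "x \<in> hspace (bits r) \<Longrightarrow> y \<in> hspace (bits r) \<Longrightarrow>
    had_op r k (x + y) = had_op r k x + had_op r k y"
  by (rule ext) (simp add: had_op_def distrib_left add_divide_distrib)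

lemma had_op_cscale: "x \<in> hspace (bits r) \<Longrightarrow>
    had_op r k (cscale c x) = cscale c (had_op r k x)"
  by (rule ext) (simp add: had_op_def cscale_def distrib_left)

lemma had_op_had_op:
  assumes "k < r" "x \<in> hspace (bits r)"
  shows "had_op r k (had_op r k x) = x"
proof
  fix a
  show "had_op r k (had_op r k x) a = x a"
    using assms had_op_in_hspace[OF assms]
    by (cases "a k") (simp_all add: had_op_apply add_divide_distrib diff_divide_distrib of_real_sqrt2_sq)
qed

lemma sum_bits_flip: "k < r \<Longrightarrow> (\<Sum>a\<in>bits r. f (flip k a)) = (\<Sum>a\<in>bits r. f a)"
  by (rule sum.reindex_bij_betw, rule bij_betw_byWitness[of _ "flip k"]) auto

text \<open>The form is preserved not site by site but on each pair \<open>a\<close>,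
  \<open>flip k a\<close>. Summing over all \<open>a\<close> meets every pair twice, hence the
  factor 2 on both sides.\<close>

lemma had_op_unitary:
  assumes k: "k < r"
  shows "had_op r k \<in> carrier (unitary_group (bits r))"
proof (rule unitaryI[of _ _ "had_op r k"])
  show "herm (bits r) (had_op r k x) (had_op r k y) = herm (bits r) x y"
    if x: "x \<in> hspace (bits r)" and y: "y \<in> hspace (bits r)" for x y
  proof -
    define F where "F a = cnj (had_op r k x a) * had_op r k y a" for a
    have "F a + F (flip k a) = cnj (x a) * y a + cnj (x (flip k a)) * y (flip k a)" for a
      using x y
      by (cases "a k") (simp_all add: F_def had_op_apply of_real_sqrt2_sq field_simps)
    then have "(\<Sum>a\<in>bits r. F a + F (flip k a)) =
        (\<Sum>a\<in>bits r. cnj (x a) * y a + cnj (x (flip k a)) * y (flip k a))"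
      by simp
    then have "2 * sum F (bits r) = 2 * (\<Sum>a\<in>bits r. cnj (x a) * y a)"
      unfolding sum.distrib sum_bits_flip[OF k, of F] sum_bits_flip[OF k, of "\<lambda>a. cnj (x a) * y a"]
      by simp
    then show ?thesis by (simp add: herm_def F_def)
  qed
qed (use k in \<open>simp_all add: had_op_had_op had_op_add had_op_cscale\<close>, simp add: had_op_def)

lemma cmod_omega: "cmod omega = 1"
  by (simp add: norm_exp_eq_Re)

lemma clifford_gates_unitary: "clifford_gates r \<subseteq> carrier (unitary_group (bits r))"
proof -
  have "perm_op (bits r) (cadd j k) \<in> carrier (unitary_group (bits r))"
    if "j < r" "k < r" "j \<noteq> k" for j k
    by (rule perm_op_unitary[of "cadd j k"]) (use that in auto)
  moreover have "diag_op (bits r) (\<lambda>a. if a k = 1 then \<i> else 1) \<in> carrier (unitary_group (bits r))" for k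
    by (rule diag_op_unitary) simp
  moreover have "diag_op (bits r) (\<lambda>_. omega) \<in> carrier (unitary_group (bits r))"
    by (rule diag_op_unitary) (simp add: cmod_omega)
  ultimately show ?thesis
    using had_op_unitary by (auto simp: clifford_gates_eq)
qed

lemma unitary_in_hspace:
  "U \<in> carrier (unitary_group I) \<Longrightarrow> x \<in> hspace I \<Longrightarrow> U x \<in> hspace I"
  by (auto simp: unitary_group_def Bij_def bij_betw_def)

text \<open>Needed because \<open>Cliff\<close> is generated inside this structure: only in a group
  does \<open>generate\<close> stay within the carrier, which makes all Clifford elements
  unitary.\<close>

lemma group_unitary_group: "group (unitary_group I)"
proof -
  let ?S = "hspace I" and ?U = "carrier (unitary_group I)"
  interpret B: group "BijGroup ?S" by (rule group_BijGroup)
  have Bij: "U \<in> Bij ?S" if "U \<in> ?U" for U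
    using that by (simp add: unitary_group_def)
  have "subgroup ?U (BijGroup ?S)"
  proof (rule B.subgroupI)
    show "?U \<subseteq> carrier (BijGroup ?S)"
      using Bij by (auto simp: BijGroup_def)
    have "(\<lambda>x\<in>?S. x) \<in> ?U"
      by (rule unitaryI[of _ _ "\<lambda>x. x"]) auto
    then show "?U \<noteq> {}" by blast
  next
    fix U assume U: "U \<in> ?U"
    let ?V = "inv_into ?S U"
    have b: "bij_betw U ?S ?S" using Bij[OF U] by (simp add: Bij_def)
    have V: "?V x \<in> ?S" "U (?V x) = x" if "x \<in> ?S" for x
      using b that by (auto simp: bij_betw_def inv_into_into f_inv_into_f)
    have VU: "?V (U x) = x" if "x \<in> ?S" for x
      using b that by (simp add: bij_betw_inv_into_left)
    have lin: "U (x + y) = U x + U y" "U (cscale c x) = cscale c (U x)" "herm I (U x) (U y) = herm I x y"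
      if "x \<in> ?S" "y \<in> ?S" for x y c
      using U that by (auto simp: unitary_group_def)
    have "(\<lambda>x\<in>?S. ?V x) \<in> ?U"
    proof (rule unitaryI[of _ _ U])
      fix x y assume x: "x \<in> ?S" and y: "y \<in> ?S"
      \<comment> \<open>Additivity of \<open>U\<close> turns the argument on the left into
        \<open>x + y\<close>, so this is additivity of the inverse.\<close>
      have "?V (U (?V x + ?V y)) = ?V x + ?V y" by (rule VU) (use V x y in auto)
      then show "(\<lambda>x\<in>?S. ?V x) (x + y) = (\<lambda>x\<in>?S. ?V x) x + (\<lambda>x\<in>?S. ?V x) y"
        using x y V lin by simp
      show "herm I ((\<lambda>x\<in>?S. ?V x) x) ((\<lambda>x\<in>?S. ?V x) y) = herm I x y"
        using x y V lin(3)[of "?V x" "?V y"] by simp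
    next
      fix c x assume x: "x \<in> ?S"
      have "?V (U (cscale c (?V x))) = cscale c (?V x)" by (rule VU) (use V x in auto)
      then show "(\<lambda>x\<in>?S. ?V x) (cscale c x) = cscale c ((\<lambda>x\<in>?S. ?V x) x)"
        using x V lin by simp
    qed (use V VU unitary_in_hspace[OF U] in auto)
    then show "inv\<^bsub>BijGroup ?S\<^esub> U \<in> ?U"
      using inv_BijGroup[OF Bij[OF U]] by simp
  next
    fix U U' assume U: "U \<in> ?U" and U': "U' \<in> ?U"
    have "compose ?S U U' \<in> ?U"
      using compose_Bij[OF Bij[OF U] Bij[OF U']] U U' unitary_in_hspace[OF U']
      by (auto simp: unitary_group_def compose_eq)
    then show "U \<otimes>\<^bsub>BijGroup ?S\<^esub> U' \<in> ?U"
      using Bij U U' by (simp add: BijGroup_def)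
  qed
  then have "group (BijGroup ?S \<lparr>carrier := ?U\<rparr>)"
    by (rule subgroup.subgroup_is_group) (rule group_BijGroup)
  then show ?thesis
    by (simp add: unitary_group_def)
qed

lemma Cliff_unitary: "Cliff r \<subseteq> carrier (unitary_group (bits r))"
  unfolding Cliff_def
  using group.generate_incl[OF group_unitary_group clifford_gates_unitary] .

lemma Cliff_gate: "g \<in> clifford_gates r \<Longrightarrow> g \<in> Cliff r"
  unfolding Cliff_def by (rule generate.incl)

lemma Cliff_compose:
  assumes "g \<in> Cliff r" "h \<in> Cliff r"
  shows "compose (hspace (bits r)) g h \<in> Cliff r"
proof -
  have "g \<in> Bij (hspace (bits r))" "h \<in> Bij (hspace (bits r))"
    using assms Cliff_unitary by (auto simp: unitary_group_def)
  then have "g \<otimes>\<^bsub>unitary_group (bits r)\<^esub> h = compose (hspace (bits r)) g h"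
    by (simp add: unitary_group_def BijGroup_def)
  then show ?thesis
    using assms unfolding Cliff_def by (metis generate.eng)
qed

section \<open>Permutations and phases in the Clifford group\<close>

lemma had_op_in_Cliff: "k < r \<Longrightarrow> had_op r k \<in> Cliff r"
  by (rule Cliff_gate) (unfold clifford_gates_eq, blast)

lemma S_op_in_Cliff: "k < r \<Longrightarrow> diag_op (bits r) (\<lambda>a. if a k = 1 then \<i> else 1) \<in> Cliff r"
  by (rule Cliff_gate) (unfold clifford_gates_eq, blast)

lemma omega_op_in_Cliff: "diag_op (bits r) (\<lambda>_. omega) \<in> Cliff r"
  by (rule Cliff_gate) (simp add: clifford_gates_eq)

lemma cadd_op_in_Cliff: "j < r \<Longrightarrow> k < r \<Longrightarrow> j \<noteq> k \<Longrightarrow> perm_op (bits r) (cadd j k) \<in> Cliff r"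
  by (rule Cliff_gate) (unfold clifford_gates_eq, blast)

lemma diag_op_in_hspace [simp]: "x \<in> hspace I \<Longrightarrow> diag_op I d x \<in> hspace I"
  by (simp add: diag_op_def hspace_def)

lemma diag_op_apply: "x \<in> hspace I \<Longrightarrow> diag_op I d x a = d a * x a"
  by (simp add: diag_op_def)

lemma perm_op_in_hspace: "(\<And>a. p a \<in> I \<longleftrightarrow> a \<in> I) \<Longrightarrow> x \<in> hspace I \<Longrightarrow> perm_op I p x \<in> hspace I"
  by (simp add: perm_op_def hspace_def)

lemma perm_op_apply: "x \<in> hspace I \<Longrightarrow> perm_op I p x a = x (p a)"
  by (simp add: perm_op_def)

text \<open>The Pauli gate \<open>X\<close> is \<open>H S\<^sup>2 H\<close>.\<close>

lemma flip_op_in_Cliff: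
  assumes k: "k < r"
  shows "perm_op (bits r) (flip k) \<in> Cliff r"
proof -
  let ?S = "hspace (bits r)" and ?D = "diag_op (bits r) (\<lambda>a. if a k = 1 then \<i> else 1)"
  have "perm_op (bits r) (flip k) =
      compose ?S (had_op r k) (compose ?S ?D (compose ?S ?D (had_op r k)))"
  proof (rule extensionalityI[of _ ?S])
    fix x assume x: "x \<in> ?S"
    show "perm_op (bits r) (flip k) x =
        compose ?S (had_op r k) (compose ?S ?D (compose ?S ?D (had_op r k))) x"
    proof
      fix a
      show "perm_op (bits r) (flip k) x a =
          compose ?S (had_op r k) (compose ?S ?D (compose ?S ?D (had_op r k))) x a"
        using x k had_op_in_hspace[OF k x]
        by (cases "a k") (simp_all add: compose_eq perm_op_apply diag_op_apply had_op_apply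
            add_divide_distrib diff_divide_distrib of_real_sqrt2_sq)
    qed
  qed (auto simp: perm_op_def)
  then show ?thesis
    using had_op_in_Cliff[OF k] S_op_in_Cliff[OF k] by (simp add: Cliff_compose)
qed

text \<open>\<open>cadd j k\<close> writes the parity \<open>a j + a k\<close> into bit
  \<open>k\<close>, where the phase gate reads it; the second CNOT restores the bit.\<close>

lemma parity_phase_in_Cliff:
  assumes jk: "j < r" "k < r" "j \<noteq> k"
  shows "diag_op (bits r) (\<lambda>a. if a j + a k = 1 then \<i> else 1) \<in> Cliff r"
proof -
  let ?S = "hspace (bits r)" and ?D = "diag_op (bits r) (\<lambda>a. if a k = 1 then \<i> else 1)"
  let ?P = "perm_op (bits r) (cadd j k)"
  have P: "?P x \<in> ?S" if "x \<in> ?S" for x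
    by (rule perm_op_in_hspace) (use jk that in auto)
  have k: "cadd j k a k = a j + a k" for a
    by (simp add: cadd_def)
  have "diag_op (bits r) (\<lambda>a. if a j + a k = 1 then \<i> else 1) = compose ?S ?P (compose ?S ?D ?P)"
  proof (rule extensionalityI[of _ ?S])
    fix x assume x: "x \<in> ?S"
    show "diag_op (bits r) (\<lambda>a. if a j + a k = 1 then \<i> else 1) x =
        compose ?S ?P (compose ?S ?D ?P) x"
      using x jk P by (intro ext) (simp add: compose_eq perm_op_apply diag_op_apply k)
  qed (auto simp: diag_op_def)
  then show ?thesis
    using cadd_op_in_Cliff[OF jk] S_op_in_Cliff[OF jk(2)] by (simp add: Cliff_compose)
qed

text \<open>Bijectivity is required on the whole index type, so that injectivity holds without side
  conditions on indices.\<close>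

definition clifford_perms :: "nat \<Rightarrow> ((nat \<Rightarrow> bit) \<Rightarrow> nat \<Rightarrow> bit) set"
  where "clifford_perms r = {p. bij p \<and> (\<forall>a. p a \<in> bits r \<longleftrightarrow> a \<in> bits r) \<and> perm_op (bits r) p \<in> Cliff r}"

lemma clifford_perms_comp:
  assumes p: "p \<in> clifford_perms r" and q: "q \<in> clifford_perms r"
  shows "(\<lambda>a. q (p a)) \<in> clifford_perms r"
proof -
  let ?S = "hspace (bits r)"
  have "perm_op (bits r) (\<lambda>a. q (p a)) = compose ?S (perm_op (bits r) p) (perm_op (bits r) q)"
  proof (rule extensionalityI[of _ ?S])
    fix x assume x: "x \<in> ?S"
    then have "perm_op (bits r) q x \<in> ?S"
      using q by (intro perm_op_in_hspace) (auto simp: clifford_perms_def)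
    then show "perm_op (bits r) (\<lambda>a. q (p a)) x = compose ?S (perm_op (bits r) p) (perm_op (bits r) q) x"
      using x by (intro ext) (simp add: compose_eq perm_op_apply)
  qed (auto simp: perm_op_def)
  then have "perm_op (bits r) (\<lambda>a. q (p a)) \<in> Cliff r"
    using p q by (simp add: clifford_perms_def Cliff_compose)
  moreover have "bij (\<lambda>a. q (p a))"
    using p q bij_comp[of p q] by (simp add: clifford_perms_def comp_def)
  ultimately show ?thesis
    using p q by (simp add: clifford_perms_def)
qed

lemma flip_clifford_perm: "k < r \<Longrightarrow> flip k \<in> clifford_perms r"
  using o_bij[of "flip k" "flip k"] by (simp add: clifford_perms_def flip_op_in_Cliff comp_def id_def)

lemma cadd_clifford_perm: "j < r \<Longrightarrow> k < r \<Longrightarrow> j \<noteq> k \<Longrightarrow> cadd j k \<in> clifford_perms r"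
  using o_bij[of "cadd j k" "cadd j k"]
  by (simp add: clifford_perms_def cadd_op_in_Cliff comp_def id_def)

lemma id_clifford_perm: "r \<ge> 1 \<Longrightarrow> (\<lambda>a. a) \<in> clifford_perms r"
  using clifford_perms_comp[OF flip_clifford_perm flip_clifford_perm, of 0 r 0] by simp

section \<open>Two-transitivity of the Clifford permutations on basis states\<close>

lemma bits_less: "a \<in> bits r \<Longrightarrow> a k = 1 \<Longrightarrow> k < r"
  by (rule ccontr) (simp add: bits_def)

lemma finite_support_bits: "a \<in> bits r \<Longrightarrow> finite {k. a k = 1}"
  by (rule finite_subset[of _ "{..<r}"]) (auto dest: bits_less)

text \<open>Induction on the number of ones: flipping a one lowers it.\<close>

lemma clifford_perm_to_zero:
  assumes r: "r \<ge> 1" and a: "a \<in> bits r"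
  shows "\<exists>p\<in>clifford_perms r. p a = (\<lambda>_. 0)"
  using a
proof (induction "card {k. a k = 1}" arbitrary: a rule: less_induct)
  case less
  show ?case
  proof (cases "\<exists>k. a k = 1")
    case True
    then obtain k where k: "a k = 1" by blast
    with less.prems have kr: "k < r" by (auto dest: bits_less)
    have "{l. flip k a l = 1} = {l. a l = 1} - {k}"
      using k by (auto simp: flip_def)
    with k have "{l. flip k a l = 1} \<subset> {l. a l = 1}" by blast
    then have "card {l. flip k a l = 1} < card {l. a l = 1}"
      using finite_support_bits[OF less.prems] by (simp add: psubset_card_mono)
    then obtain p where p: "p \<in> clifford_perms r" "p (flip k a) = (\<lambda>_. 0)"
      using less.hyps[of "flip k a"] less.prems kr by auto
    have "(\<lambda>b. p (flip k b)) \<in> clifford_perms r"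
      by (rule clifford_perms_comp[OF flip_clifford_perm[OF kr] p(1)])
    with p(2) show ?thesis by (intro bexI[of _ "\<lambda>b. p (flip k b)"]) simp_all
  next
    case False
    then have "a = (\<lambda>_. 0)" by auto
    then show ?thesis
      using id_clifford_perm[OF r] by (intro bexI[of _ "\<lambda>a. a"]) simp_all
  qed
qed

text \<open>With bit 0 set, \<open>cadd 0 k\<close> clears a one at \<open>k\<close>. It never
  changes bit 0, and it fixes the zero string, so induction on the number of ones applies.\<close>

lemma clifford_perm_to_unit_aux:
  assumes r: "r \<ge> 1" and a: "a \<in> bits r" "a 0 = 1"
  shows "\<exists>p\<in>clifford_perms r. p (\<lambda>_. 0) = (\<lambda>_. 0) \<and> p a = flip 0 (\<lambda>_. 0)"
  using a
proof (induction "card {k. a k = 1}" arbitrary: a rule: less_induct)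
  case less
  show ?case
  proof (cases "\<exists>k. k \<noteq> 0 \<and> a k = 1")
    case True
    then obtain k where k: "k \<noteq> 0" "a k = 1" by blast
    with less.prems have kr: "k < r" by (auto dest: bits_less)
    let ?b = "cadd 0 k a"
    have "{l. ?b l = 1} = {l. a l = 1} - {k}"
      using k less.prems(2) by (auto simp: cadd_def)
    with k have "{l. ?b l = 1} \<subset> {l. a l = 1}" by blast
    then have "card {l. ?b l = 1} < card {l. a l = 1}"
      using finite_support_bits[OF less.prems(1)] by (simp add: psubset_card_mono)
    moreover have "?b \<in> bits r" "?b 0 = 1"
      using less.prems kr r k by (simp, simp add: cadd_def)
    ultimately obtain p where p: "p \<in> clifford_perms r" "p (\<lambda>_. 0) = (\<lambda>_. 0)" "p ?b = flip 0 (\<lambda>_. 0)"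
      using less.hyps[of ?b] by auto
    have "(\<lambda>b. p (cadd 0 k b)) \<in> clifford_perms r"
      using clifford_perms_comp[OF cadd_clifford_perm p(1), of 0 k] kr r k by simp
    moreover have "cadd 0 k (\<lambda>_. 0) = (\<lambda>_. 0)" by (auto simp: cadd_def)
    ultimately show ?thesis using p by (intro bexI[of _ "\<lambda>b. p (cadd 0 k b)"]) simp_all
  next
    case False
    have "a l = 0" if "l \<noteq> 0" for l using that False by (metis bit_not_zero_iff)
    with less.prems have "a l = flip 0 (\<lambda>_. 0) l" for l by (cases "l = 0") (simp_all add: flip_def)
    then have "a = flip 0 (\<lambda>_. 0)" by blast
    then show ?thesis
      using id_clifford_perm[OF r] by (intro bexI[of _ "\<lambda>a. a"]) simp_all
  qed
qed

text \<open>If bit 0 is clear, a CNOT controlled by any one of \<open>a\<close> sets it, again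
  fixing the zero string.\<close>

lemma clifford_perm_to_unit:
  assumes r: "r \<ge> 1" and a: "a \<in> bits r" "a \<noteq> (\<lambda>_. 0)"
  shows "\<exists>p\<in>clifford_perms r. p (\<lambda>_. 0) = (\<lambda>_. 0) \<and> p a = flip 0 (\<lambda>_. 0)"
proof (cases "a 0 = 1")
  case False
  obtain k where k: "a k = 1" using a(2) by (metis bit_not_zero_iff ext)
  with a(1) have kr: "k < r" by (rule bits_less)
  have k0: "k \<noteq> 0" using False k by metis
  have "cadd k 0 a \<in> bits r" "cadd k 0 a 0 = 1"
    using a kr r k False by (simp, simp add: cadd_def)
  then obtain p where p: "p \<in> clifford_perms r" "p (\<lambda>_. 0) = (\<lambda>_. 0)" "p (cadd k 0 a) = flip 0 (\<lambda>_. 0)"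
    using clifford_perm_to_unit_aux[OF r] by blast
  have "(\<lambda>b. p (cadd k 0 b)) \<in> clifford_perms r"
    using clifford_perms_comp[OF cadd_clifford_perm p(1), of k 0] kr r k0 by simp
  moreover have "cadd k 0 (\<lambda>_. 0) = (\<lambda>_. 0)" by (auto simp: cadd_def)
  ultimately show ?thesis using p by (intro bexI[of _ "\<lambda>b. p (cadd k 0 b)"]) simp_all
qed (use clifford_perm_to_unit_aux assms in blast)

text \<open>After \<open>a\<close> has been moved to zero, injectivity keeps the image of
  \<open>b\<close> nonzero, and that image is corrected by a map fixing zero.\<close>

lemma clifford_perms_two_transitive:
  assumes r: "r \<ge> 1" and ab: "a \<in> bits r" "b \<in> bits r" "a \<noteq> b"
  shows "\<exists>p\<in>clifford_perms r. p a = (\<lambda>_. 0) \<and> p b = flip 0 (\<lambda>_. 0)"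
proof -
  obtain p where p: "p \<in> clifford_perms r" "p a = (\<lambda>_. 0)"
    using clifford_perm_to_zero[OF r ab(1)] by blast
  have "inj p" using p(1) by (simp add: clifford_perms_def bij_is_inj)
  then have "p b \<noteq> (\<lambda>_. 0)" using p(2) ab(3) by (metis injD)
  moreover have "p b \<in> bits r" using p(1) ab by (simp add: clifford_perms_def)
  ultimately
  obtain q where q: "q \<in> clifford_perms r" "q (\<lambda>_. 0) = (\<lambda>_. 0)" "q (p b) = flip 0 (\<lambda>_. 0)"
    using clifford_perm_to_unit[OF r] by blast
  have "(\<lambda>a. q (p a)) \<in> clifford_perms r" by (rule clifford_perms_comp[OF p(1) q(1)])
  with p q show ?thesis by (intro bexI[of _ "\<lambda>a. q (p a)"]) simp_all
qed

section \<open>The commutant\<close>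

text \<open>The amplitude is an argument because the real basis consists of the kets with amplitudes
  \<open>1\<close> and \<open>\<i>\<close>.\<close>

definition ket :: "'i \<Rightarrow> complex \<Rightarrow> 'i \<Rightarrow> complex"
  where "ket a z = (\<lambda>b. if b = a then z else 0)"

lemma ket_in_hspace [simp]: "a \<in> I \<Longrightarrow> ket a z \<in> hspace I"
  by (auto simp: ket_def hspace_def)

lemma subspace_hspace: "subspace (hspace I)"
  by (simp add: subspace_def)

lemma sum_ket:
  assumes "finite I" "x \<in> hspace I"
  shows "(\<Sum>a\<in>I. ket a (x a)) = x"
proof
  fix b
  have "(\<Sum>a\<in>A. ket a (x a)) b = (\<Sum>a\<in>A. ket a (x a) b)" for A
    by (induction A rule: infinite_finite_induct) simp_all
  then show "(\<Sum>a\<in>I. ket a (x a)) b = x b"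
    using assms by (auto simp: ket_def hspace_def)
qed

lemma real_linear_on_sum:
  assumes A: "real_linear_on S A" and S: "subspace S" and J: "\<And>a. a \<in> J \<Longrightarrow> f a \<in> S"
  shows "A (sum f J) = (\<Sum>a\<in>J. A (f a))"
proof -
  have 0: "A 0 = 0"
    using A subspace_0[OF S] unfolding real_linear_on_def by (metis scaleR_zero_left)
  show ?thesis using J
  proof (induction J rule: infinite_finite_induct)
    case (insert a J)
    then have "f a \<in> S" "sum f J \<in> S" using subspace_sum[OF S, of J f] by auto
    then have "A (f a + sum f J) = A (f a) + A (sum f J)"
      using A unfolding real_linear_on_def by blast
    also have "A (sum f J) = (\<Sum>a\<in>J. A (f a))" using insert by blast
    finally show ?case by (simp only: sum.insert[OF insert.hyps])
  qed (simp_all add: 0)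
qed

lemma omega_sq: "omega * omega = \<i>"
proof -
  have "omega * omega = exp (\<i> * of_real (pi / 2))"
    by (simp add: mult_ac flip: exp_add)
  also have "\<dots> = cis (pi / 2)" by (simp only: cis_conv_exp)
  finally show ?thesis by simp
qed

lemma End_G_Cliff_subset:
  assumes r: "r \<ge> 1" and A: "A \<in> End_G (bits r) (Cliff r)"
  shows "A \<in> complex_scalars (bits r)"
proof -
  let ?S = "hspace (bits r)" and ?e = "\<lambda>a. ket a 1"
  have comm: "A (g x) = g (A x)" if "g \<in> Cliff r" "x \<in> ?S" for g x
    using A that by (simp add: End_G_def)
  have AS: "A x \<in> ?S" if "x \<in> ?S" for x
    using A that by (auto simp: End_G_def)
  have lin: "real_linear_on ?S A" using A by (simp add: End_G_def)
  have i: "A (cscale \<i> x) = cscale \<i> (A x)" if x: "x \<in> ?S" for x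
  proof -
    let ?W = "diag_op (bits r) (\<lambda>_. omega)"
    have W2: "?W (?W y) = cscale \<i> y" if "y \<in> ?S" for y
      using that omega_sq by (intro ext) (simp add: diag_op_apply cscale_def flip: mult.assoc)
    have "A (?W (?W x)) = ?W (?W (A x))"
      using comm[OF omega_op_in_Cliff] x by simp
    then show ?thesis using W2 x AS by simp
  qed
  have clin: "A (cscale c x) = cscale c (A x)" if x: "x \<in> ?S" for c x
  proof -
    \<comment> \<open>Real linearity together with commutation with \<open>\<i>\<close> yields
      complex linearity through this decomposition.\<close>
    have split: "cscale c y = Re c *\<^sub>R y + Im c *\<^sub>R cscale \<i> y" for y :: "(nat \<Rightarrow> bit) \<Rightarrow> complex"
      by (rule ext) (simp add: cscale_def scaleR_fun_def complex_eq_iff)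
    show ?thesis
      using lin x i[OF x] unfolding split[of x] split[of "A x"] by (simp add: real_linear_on_def)
  qed
  \<comment> \<open>At a qubit where \<open>a\<close> and \<open>b\<close> differ, the phase gate
    has eigenvalues \<open>1\<close> and \<open>\<i>\<close> on the two basis vectors, in some
    order, and \<open>A\<close> respects its eigenspaces.\<close>
  have offdiag: "A (?e a) b = 0" if a: "a \<in> bits r" and ne: "a \<noteq> b" for a b
  proof (cases "b \<in> bits r")
    case True
    obtain k where k: "a k \<noteq> b k" using ne by (auto simp: fun_eq_iff)
    with a True have kr: "k < r"
      using bits_less[of a r k] bits_less[of b r k] by (cases "a k"; cases "b k") auto
    let ?s = "\<lambda>a. if a k = (1::bit) then \<i> else 1"
    have "diag_op (bits r) ?s (?e a) = cscale (?s a) (?e a)"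
      using diag_op_apply[OF ket_in_hspace[OF a]] by (intro ext) (simp add: cscale_def ket_def)
    then have "A (cscale (?s a) (?e a)) = diag_op (bits r) ?s (A (?e a))"
      using comm[OF S_op_in_Cliff[OF kr], of "?e a"] a by simp
    then have "cscale (?s a) (A (?e a)) b = diag_op (bits r) ?s (A (?e a)) b"
      using clin a by simp
    then have "(?s a - ?s b) * A (?e a) b = 0"
      using AS a by (simp add: cscale_def diag_op_apply algebra_simps)
    moreover have "?s a - ?s b \<noteq> 0" using k by (cases "a k"; cases "b k") (auto simp: complex_eq_iff)
    ultimately show ?thesis by simp
  next
    case False
    then show ?thesis using hspaceD[OF AS[OF ket_in_hspace[OF a]]] by blast
  qed
  \<comment> \<open>By pull-back, a map with \<open>p a = 0\<close> carries the basis vector at zero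
    to the one at \<open>a\<close>; commutation transports the diagonal entry.\<close>
  have diag: "A (?e a) a = A (?e (\<lambda>_. 0)) (\<lambda>_. 0)" if a: "a \<in> bits r" for a
  proof -
    obtain p where p: "p \<in> clifford_perms r" "p a = (\<lambda>_. 0)"
      using clifford_perm_to_zero[OF r a] by blast
    have "inj p" using p(1) by (simp add: clifford_perms_def bij_is_inj)
    then have "p b = (\<lambda>_. 0) \<longleftrightarrow> b = a" for b using p(2) by (metis injD)
    then have "perm_op (bits r) p (?e (\<lambda>_. 0)) = ?e a"
      using perm_op_apply[OF ket_in_hspace[OF zero_in_bits]] by (intro ext) (simp add: ket_def)
    then have "A (?e a) = perm_op (bits r) p (A (?e (\<lambda>_. 0)))"
      using comm[of "perm_op (bits r) p" "?e (\<lambda>_. 0)"] p(1) by (simp add: clifford_perms_def)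
    then show ?thesis using AS p(2) by (simp add: perm_op_apply)
  qed
  define c where "c = A (?e (\<lambda>_. 0)) (\<lambda>_. 0)"
  have e: "A (?e a) = cscale c (?e a)" if "a \<in> bits r" for a
    using offdiag[OF that] diag[OF that] by (intro ext) (auto simp: c_def cscale_def ket_def)
  have "A x = cscale c x" if x: "x \<in> ?S" for x
  proof -
    have ket: "ket a z = cscale z (?e a)" for a :: "nat \<Rightarrow> bit" and z
      by (rule ext) (simp add: ket_def cscale_def)
    have "A x = A (\<Sum>a\<in>bits r. ket a (x a))" using x by (simp add: sum_ket)
    also have "\<dots> = (\<Sum>a\<in>bits r. A (ket a (x a)))"
      by (rule real_linear_on_sum[OF lin subspace_hspace]) simp
    also have "\<dots> = (\<Sum>a\<in>bits r. ket a (cscale c x a))"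
    proof (rule sum.cong[OF refl])
      fix a assume a: "a \<in> bits r"
      have "A (ket a (x a)) = cscale (x a) (cscale c (?e a))"
        using a clin e by (simp add: ket[of a "x a"])
      also have "\<dots> = ket a (cscale c x a)" by (rule ext) (simp add: cscale_def ket_def)
      finally show "A (ket a (x a)) = ket a (cscale c x a)" .
    qed
    also have "\<dots> = cscale c x" using x by (intro sum_ket) auto
    finally show ?thesis .
  qed
  moreover have "A \<in> extensional ?S" using A by (auto simp: End_G_def PiE_def)
  ultimately have "A = (\<lambda>x\<in>?S. cscale c x)"
    by (intro extensionalityI[of _ ?S]) auto
  then show ?thesis by (auto simp: complex_scalars_def)
qed

lemma End_G_Cliff:
  assumes r: "r \<ge> 1"
  shows "End_G (bits r) (Cliff r) = complex_scalars (bits r)"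
proof (intro equalityI subsetI)
  fix A assume "A \<in> complex_scalars (bits r)"
  then obtain c where A: "A = (\<lambda>x\<in>hspace (bits r). cscale c x)"
    by (auto simp: complex_scalars_def)
  have "g (cscale c x) = cscale c (g x)" "g x \<in> hspace (bits r)"
    if "g \<in> Cliff r" "x \<in> hspace (bits r)" for g x
  proof -
    have g: "g \<in> carrier (unitary_group (bits r))" using Cliff_unitary that by blast
    then show "g x \<in> hspace (bits r)" using unitary_in_hspace that by blast
    show "g (cscale c x) = cscale c (g x)" using g that by (simp add: unitary_group_def)
  qed
  moreover have "real_linear_on (hspace (bits r)) A"
  proof -
    have "cscale c (x + y) = cscale c x + cscale c y" "cscale c (t *\<^sub>R x) = t *\<^sub>R cscale c x" for x y :: "(nat \<Rightarrow> bit) \<Rightarrow> complex" and t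
      by (auto simp: fun_eq_iff cscale_def scaleR_fun_def distrib_left)
    then show ?thesis unfolding real_linear_on_def A by simp
  qed
  ultimately show "A \<in> End_G (bits r) (Cliff r)"
    by (auto simp: End_G_def A)
qed (rule End_G_Cliff_subset[OF r])

section \<open>Quartic forms as combinations of monomials\<close>

lemma subspace_V_space: "subspace (V_space I)"
  unfolding V_space_def by (rule subspace_Times[OF subspace_hspace subspace_hspace])

lemma component_in_hspace: "x \<in> V_space I \<Longrightarrow> component x i \<in> hspace I"
  by (auto simp: V_space_def component_def)

lemma component_map_prod: "component (map_prod g g x) i = g (component x i)"
  by (simp add: component_def)

type_synonym 'i letter = "bool \<times> 2 \<times> 'i"

text \<open>Coordinates and conjugates are preferred to real and imaginary parts because every
  diagonal operator multiplies such a letter by a scalar.\<close>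

definition letter_val :: "'i letter \<Rightarrow> 'i pairvec \<Rightarrow> complex"
  where "letter_val s x = (case s of (e, i, a) \<Rightarrow> if e then cnj (component x i a) else component x i a)"

abbreviation letters :: "'i set \<Rightarrow> 'i letter set"
  where "letters I \<equiv> UNIV \<times> UNIV \<times> I"

definition word_val :: "'i letter \<times> 'i letter \<times> 'i letter \<times> 'i letter \<Rightarrow> 'i pairvec \<Rightarrow> complex"
  where "word_val w x = (case w of (s, t, u, v) \<Rightarrow>
    letter_val s x * letter_val t x * letter_val u x * letter_val v x)"

abbreviation words4 :: "'i set \<Rightarrow> ('i letter \<times> 'i letter \<times> 'i letter \<times> 'i letter) set"
  where "words4 I \<equiv> letters I \<times> letters I \<times> letters I \<times> letters I"

definition slot :: "2 \<Rightarrow> ('i \<Rightarrow> complex) \<Rightarrow> 'i pairvec"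
  where "slot i y = (if i = 1 then (y, 0) else (0, y))"

lemma slot_in_V_space: "y \<in> hspace I \<Longrightarrow> slot i y \<in> V_space I"
  by (simp add: slot_def V_space_def)

lemma slot_add: "slot i (y + z) = slot i y + slot i z"
  and slot_scaleR: "slot i (t *\<^sub>R y) = t *\<^sub>R slot i y"
  by (simp_all add: slot_def)

lemma slot_sum: "slot i (sum y J) = (\<Sum>a\<in>J. slot i (y a))"
proof (induction J rule: infinite_finite_induct)
  case (insert a J)
  then show ?case by (simp only: sum.insert[OF insert.hyps] slot_add)
qed (simp_all add: slot_def zero_prod_def zero_fun_def)

lemma sum_slot_component: "(\<Sum>i\<in>UNIV. slot i (component x i)) = x"
  by (simp add: sum_2 slot_def component_def)

text \<open>A real-linear functional is determined by its values on the real basis vectors in both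
  slots; on one complex coordinate it is a combination of \<open>z\<close> and
  \<open>cnj z\<close>.\<close>

lemma V_dual_expand:
  assumes I: "finite I" and f: "f \<in> V_dual I"
  shows "\<exists>c. \<forall>x\<in>V_space I. complex_of_real (f x) = (\<Sum>s\<in>letters I. c s * letter_val s x)"
proof -
  have lin: "real_linear_on (V_space I) f" using f by (simp add: V_dual_def)
  define p where "p i a = complex_of_real (f (slot i (ket a 1)))" for i a
  define q where "q i a = complex_of_real (f (slot i (ket a \<i>)))" for i a
  \<comment> \<open>Obtained from \<open>p * Re z + q * Im z = (p - \<i> * q) / 2 * z + (p + \<i> *
    q) / 2 * cnj z\<close>.\<close>
  define c where "c s = (case s of (e, i, a) \<Rightarrow> (if e then p i a + \<i> * q i a else p i a - \<i> * q i a) / 2)"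
    for s :: "'a letter"
  have "complex_of_real (f x) = (\<Sum>s\<in>letters I. c s * letter_val s x)" if x: "x \<in> V_space I" for x
  proof -
    have one: "complex_of_real (f (slot i (ket a z))) = c (False, i, a) * z + c (True, i, a) * cnj z"
      if a: "a \<in> I" for i a z
    proof -
      have "ket a z = Re z *\<^sub>R ket a 1 + Im z *\<^sub>R ket a \<i>"
        by (rule ext) (simp add: ket_def scaleR_fun_def complex_eq_iff)
      then have "slot i (ket a z) = Re z *\<^sub>R slot i (ket a 1) + Im z *\<^sub>R slot i (ket a \<i>)"
        by (simp only: slot_add slot_scaleR)
      moreover have "f (Re z *\<^sub>R slot i (ket a 1) + Im z *\<^sub>R slot i (ket a \<i>)) =
          Re z * f (slot i (ket a 1)) + Im z * f (slot i (ket a \<i>))"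
      proof -
        have "slot i (ket a w) \<in> V_space I" "t *\<^sub>R slot i (ket a w) \<in> V_space I" for t w
          using slot_in_V_space[OF ket_in_hspace[OF a]] subspace_scale[OF subspace_V_space] by blast+
        then show ?thesis using lin unfolding real_linear_on_def by simp
      qed
      ultimately have "complex_of_real (f (slot i (ket a z))) = of_real (Re z) * p i a + of_real (Im z) * q i a"
        by (simp add: p_def q_def)
      also have "\<dots> = c (False, i, a) * z + c (True, i, a) * cnj z"
        by (simp add: c_def p_def q_def complex_eq_iff field_simps)
      finally show ?thesis .
    qed
    have "f x = f (\<Sum>i\<in>UNIV. slot i (component x i))"
      by (simp only: sum_slot_component)
    also have "\<dots> = (\<Sum>i\<in>UNIV. f (slot i (component x i)))"
      using component_in_hspace[OF x] by (intro real_linear_on_sum[OF lin subspace_V_space] slot_in_V_space)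
    also have "\<dots> = (\<Sum>i\<in>UNIV. f (\<Sum>a\<in>I. slot i (ket a (component x i a))))"
      using sum_ket[OF I component_in_hspace[OF x]] by (simp only: flip: slot_sum)
    also have "\<dots> = (\<Sum>i\<in>UNIV. \<Sum>a\<in>I. f (slot i (ket a (component x i a))))"
      by (intro sum.cong[OF refl] real_linear_on_sum[OF lin subspace_V_space] slot_in_V_space ket_in_hspace)
    finally have "complex_of_real (f x) = (\<Sum>i\<in>UNIV. \<Sum>a\<in>I.
        c (False, i, a) * component x i a + c (True, i, a) * cnj (component x i a))"
      by (simp add: one)
    also have "\<dots> = (\<Sum>e\<in>UNIV. \<Sum>i\<in>UNIV. \<Sum>a\<in>I. c (e, i, a) * letter_val (e, i, a) x)"
      by (simp add: UNIV_bool letter_val_def sum.distrib)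
    also have "\<dots> = (\<Sum>s\<in>letters I. c s * letter_val s x)"
      by (simp add: sum.cartesian_product)
    finally show ?thesis .
  qed
  then show ?thesis by blast
qed

text \<open>The functions with such an expansion form a real subspace, even though the coefficients
  are complex. It contains the generators, since a product of four linear expansions multiplies out
  into words.\<close>

lemma Sym4_expand:
  assumes I: "finite I" and f: "f \<in> Sym4 I"
  shows "\<exists>c. \<forall>x\<in>V_space I. complex_of_real (f x) = (\<Sum>w\<in>words4 I. c w * word_val w x)"
proof -
  define S where "S = {f. \<exists>c. \<forall>x\<in>V_space I. complex_of_real (f x) = (\<Sum>w\<in>words4 I. c w * word_val w x)}"
  have SI: "f \<in> S" if "\<forall>x\<in>V_space I. complex_of_real (f x) = (\<Sum>w\<in>words4 I. c w * word_val w x)" for f c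
    using that unfolding S_def by blast
  have "subspace S"
    unfolding subspace_def
  proof (intro conjI ballI allI)
    show "0 \<in> S" by (rule SI[of _ "\<lambda>_. 0"]) simp
  next
    fix f g assume "f \<in> S" "g \<in> S"
    then obtain c d where "\<forall>x\<in>V_space I. complex_of_real (f x) = (\<Sum>w\<in>words4 I. c w * word_val w x)"
      "\<forall>x\<in>V_space I. complex_of_real (g x) = (\<Sum>w\<in>words4 I. d w * word_val w x)"
      by (auto simp: S_def)
    then have "\<forall>x\<in>V_space I. complex_of_real ((f + g) x) = (\<Sum>w\<in>words4 I. (c w + d w) * word_val w x)"
      by (simp add: distrib_right sum.distrib)
    then show "f + g \<in> S" by (rule SI)
  next
    fix t f assume "f \<in> S"
    then obtain c where "\<forall>x\<in>V_space I. complex_of_real (f x) = (\<Sum>w\<in>words4 I. c w * word_val w x)"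
      by (auto simp: S_def)
    then have "\<forall>x\<in>V_space I. complex_of_real ((t *\<^sub>R f) x) =
        (\<Sum>w\<in>words4 I. (of_real t * c w) * word_val w x)"
      by (simp add: scaleR_fun_def sum_distrib_left mult.assoc)
    then show "t *\<^sub>R f \<in> S" by (rule SI)
  qed
  moreover have "f1 * f2 * f3 * f4 \<in> S"
    if V: "f1 \<in> V_dual I" "f2 \<in> V_dual I" "f3 \<in> V_dual I" "f4 \<in> V_dual I" for f1 f2 f3 f4
  proof -
    have ex: "\<exists>c. \<forall>x\<in>V_space I. complex_of_real (f x) = (\<Sum>s\<in>letters I. c s * letter_val s x)"
      if "f \<in> V_dual I" for f
      by (rule V_dual_expand[OF I that])
    obtain c1 where c1: "\<forall>x\<in>V_space I. complex_of_real (f1 x) = (\<Sum>s\<in>letters I. c1 s * letter_val s x)"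
      using ex[OF V(1)] ..
    obtain c2 where c2: "\<forall>x\<in>V_space I. complex_of_real (f2 x) = (\<Sum>s\<in>letters I. c2 s * letter_val s x)"
      using ex[OF V(2)] ..
    obtain c3 where c3: "\<forall>x\<in>V_space I. complex_of_real (f3 x) = (\<Sum>s\<in>letters I. c3 s * letter_val s x)"
      using ex[OF V(3)] ..
    obtain c4 where c4: "\<forall>x\<in>V_space I. complex_of_real (f4 x) = (\<Sum>s\<in>letters I. c4 s * letter_val s x)"
      using ex[OF V(4)] ..
    have prod: "sum p P * sum q Q = (\<Sum>(s, t)\<in>P \<times> Q. p s * q t)"
      for p :: "'b \<Rightarrow> complex" and q :: "'c \<Rightarrow> complex" and P Q
      by (simp only: sum_product sum.cartesian_product)
    have "complex_of_real ((f1 * f2 * f3 * f4) x) =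
        (\<Sum>w\<in>words4 I. (case w of (s, t, u, v) \<Rightarrow> c1 s * c2 t * c3 u * c4 v) * word_val w x)"
      if x: "x \<in> V_space I" for x
    proof -
      have "complex_of_real ((f1 * f2 * f3 * f4) x) =
          complex_of_real (f1 x) * (complex_of_real (f2 x) * (complex_of_real (f3 x) * complex_of_real (f4 x)))"
        by simp
      also have "\<dots> = (\<Sum>w\<in>words4 I. (case w of (s, t, u, v) \<Rightarrow> c1 s * c2 t * c3 u * c4 v) * word_val w x)"
        unfolding bspec[OF c1 x] bspec[OF c2 x] bspec[OF c3 x] bspec[OF c4 x] prod
        by (rule sum.cong[OF refl]) (simp add: word_val_def split_beta mult_ac)
      finally show ?thesis .
    qed
    then show ?thesis by (intro SI ballI)
  qed
  ultimately have "Sym4 I \<subseteq> S"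
    unfolding Sym4_def by (intro span_minimal) auto
  then show ?thesis using f by (auto simp: S_def)
qed

text \<open>Averaging over the powers of \<open>g\<close> projects onto the monomials fixed by \<open>g\<close>.\<close>

lemma invariant_eigen_expansion:
  fixes c l :: "'t \<Rightarrow> complex" and F :: "'x \<Rightarrow> complex"
  assumes F: "\<And>x. x \<in> V \<Longrightarrow> F x = (\<Sum>t\<in>T. c t * m t x)"
    and g: "\<And>x. x \<in> V \<Longrightarrow> g x \<in> V" "\<And>x. x \<in> V \<Longrightarrow> F (g x) = F x"
    and m: "\<And>t x. t \<in> T \<Longrightarrow> x \<in> V \<Longrightarrow> m t (g x) = l t * m t x"
    and l: "\<And>t. t \<in> T \<Longrightarrow> l t ^ n = 1" and n: "n > 0" and T: "finite T" and x: "x \<in> V"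
  shows "F x = (\<Sum>t\<in>{t \<in> T. l t = 1}. c t * m t x)"
proof -
  \<comment> \<open>Invariance allows \<open>x\<close> to be replaced by \<open>g x\<close>, which
    multiplies each coefficient by its eigenvalue.\<close>
  have pow: "F x = (\<Sum>t\<in>T. c t * l t ^ k * m t x)" if "x \<in> V" for k x
    using that
  proof (induction k arbitrary: x)
    case 0
    then show ?case using F by simp
  next
    case (Suc k)
    have "F x = F (g x)" using g Suc.prems by simp
    also have "\<dots> = (\<Sum>t\<in>T. c t * l t ^ k * m t (g x))" using Suc g by simp
    finally show ?case using m Suc.prems by (simp add: mult_ac)
  qed
  \<comment> \<open>Geometric sum: for \<open>l t \<noteq> 1\<close> the numerator vanishes because
    \<open>l t ^ n = 1\<close>.\<close>
  have avg: "(\<Sum>k<n. l t ^ k) = (if l t = 1 then of_nat n else 0)" if "t \<in> T" for t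
    using l[OF that] by (simp add: geometric_sum)
  have "of_nat n * F x = (\<Sum>k<n. F x)" by simp
  also have "\<dots> = (\<Sum>k<n. \<Sum>t\<in>T. c t * l t ^ k * m t x)"
    by (rule sum.cong[OF refl]) (rule pow[OF x])
  also have "\<dots> = (\<Sum>t\<in>T. \<Sum>k<n. c t * l t ^ k * m t x)" by (rule sum.swap)
  also have "\<dots> = (\<Sum>t\<in>T. c t * (\<Sum>k<n. l t ^ k) * m t x)"
    by (simp add: sum_distrib_left sum_distrib_right)
  also have "\<dots> = (\<Sum>t\<in>T. if l t = 1 then of_nat n * (c t * m t x) else 0)"
    by (rule sum.cong[OF refl]) (simp add: avg)
  also have "\<dots> = of_nat n * (\<Sum>t\<in>{t \<in> T. l t = 1}. c t * m t x)"
    unfolding sum.inter_filter[OF T] sum_distrib_left by (rule sum.cong) simp_all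
  finally show ?thesis using n by simp
qed

text \<open>One operator at a time: the filtered sum is again an expansion of \<open>F\<close> with
  the same coefficients, so the single-operator result applies to it.\<close>

lemma invariant_eigen_expansion_family:
  fixes c :: "'t \<Rightarrow> complex" and l :: "'d \<Rightarrow> 't \<Rightarrow> complex" and F :: "'x \<Rightarrow> complex"
  assumes D: "finite D" and F: "\<And>x. x \<in> V \<Longrightarrow> F x = (\<Sum>t\<in>T. c t * m t x)"
    and g: "\<And>d x. d \<in> D \<Longrightarrow> x \<in> V \<Longrightarrow> g d x \<in> V"
      "\<And>d x. d \<in> D \<Longrightarrow> x \<in> V \<Longrightarrow> F (g d x) = F x"
    and m: "\<And>d t x. d \<in> D \<Longrightarrow> t \<in> T \<Longrightarrow> x \<in> V \<Longrightarrow> m t (g d x) = l d t * m t x"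
    and l: "\<And>d t. d \<in> D \<Longrightarrow> t \<in> T \<Longrightarrow> l d t ^ n = 1" and n: "n > 0" and T: "finite T" and x: "x \<in> V"
  shows "F x = (\<Sum>t\<in>{t \<in> T. \<forall>d\<in>D. l d t = 1}. c t * m t x)"
  using D g m l x
proof (induction D arbitrary: x)
  case empty
  then show ?case using F by simp
next
  case (insert d D)
  have "F x = (\<Sum>t\<in>{t \<in> {t \<in> T. \<forall>d\<in>D. l d t = 1}. l d t = 1}. c t * m t x)"
  proof (rule invariant_eigen_expansion[where V = V and g = "g d" and n = n])
    show "F x = (\<Sum>t\<in>{t \<in> T. \<forall>d\<in>D. l d t = 1}. c t * m t x)" if "x \<in> V" for x
      using insert that by simp
  qed (use insert n T in auto)
  also have "{t \<in> {t \<in> T. \<forall>d\<in>D. l d t = 1}. l d t = 1} = {t \<in> T. \<forall>d\<in>insert d D. l d t = 1}"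
    by auto
  finally show ?case .
qed

section \<open>Words fixed by the diagonal Clifford operators\<close>

text \<open>The scalar forces equally many plain and conjugated letters, the single-qubit phases
  match indices at each qubit, and the parity phases make these matchings agree.\<close>

definition clifford_phases :: "nat \<Rightarrow> ((nat \<Rightarrow> bit) \<Rightarrow> complex) set"
  where "clifford_phases r = {\<lambda>_. omega} \<union> {\<lambda>a. if a k = 1 then \<i> else 1 | k. k < r} \<union>
    {\<lambda>a. if a j + a k = 1 then \<i> else 1 | j k. j < r \<and> k < r \<and> j \<noteq> k}"

lemma finite_clifford_phases: "finite (clifford_phases r)"
proof -
  let ?f = "\<lambda>(j, k) (a :: nat \<Rightarrow> bit). if a j + a k = 1 then \<i> else 1"
  have "{\<lambda>a. if a k = (1::bit) then \<i> else 1 | k. k < r} = (\<lambda>k a. if a k = 1 then \<i> else 1) ` {..<r}"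
    by blast
  moreover have "{\<lambda>a. if a j + a k = (1::bit) then \<i> else 1 | j k. j < r \<and> k < r \<and> j \<noteq> k} \<subseteq>
      ?f ` ({..<r} \<times> {..<r})"
    by (intro subsetI, elim CollectE exE conjE) (rule_tac x = "(j, k)" in image_eqI, simp_all)
  ultimately show ?thesis
    unfolding clifford_phases_def
    by (simp only: finite_Un finite_insert finite.emptyI finite_imageI finite_lessThan simp_thms)
      (rule finite_subset, assumption, simp)
qed

lemma clifford_phases_in_Cliff:
  assumes "d \<in> clifford_phases r"
  shows "diag_op (bits r) d \<in> Cliff r"
  using assms omega_op_in_Cliff S_op_in_Cliff parity_phase_in_Cliff
  unfolding clifford_phases_def by blast

lemma omega_pow_8: "omega ^ 8 = 1"
proof -
  have "z ^ 8 = (z * z) ^ 4" for z :: complex by (simp flip: power2_eq_square power_mult)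
  from this[of omega] show ?thesis by (simp only: omega_sq) (simp add: eval_nat_numeral)
qed

lemma clifford_phases_pow_8:
  assumes "d \<in> clifford_phases r"
  shows "d a ^ 8 = 1"
proof -
  have "\<i> ^ 8 = 1" by (simp add: eval_nat_numeral)
  then have "(if P then \<i> else 1) ^ 8 = 1" for P by simp
  then show ?thesis
    using assms omega_pow_8 unfolding clifford_phases_def by blast
qed

definition letter_phase :: "('i \<Rightarrow> complex) \<Rightarrow> 'i letter \<Rightarrow> complex"
  where "letter_phase d s = (case s of (e, i, a) \<Rightarrow> if e then cnj (d a) else d a)"

definition word_phase :: "('i \<Rightarrow> complex) \<Rightarrow> 'i letter \<times> 'i letter \<times> 'i letter \<times> 'i letter \<Rightarrow> complex"
  where "word_phase d w = (case w of (s, t, u, v) \<Rightarrow>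
    letter_phase d s * letter_phase d t * letter_phase d u * letter_phase d v)"

lemma letter_val_diag_op:
  assumes "x \<in> V_space I"
  shows "letter_val s (map_prod (diag_op I d) (diag_op I d) x) = letter_phase d s * letter_val s x"
  using component_in_hspace[OF assms]
  by (cases s) (simp add: letter_val_def letter_phase_def component_map_prod diag_op_apply)

lemma word_val_diag_op:
  assumes "x \<in> V_space I"
  shows "word_val w (map_prod (diag_op I d) (diag_op I d) x) = word_phase d w * word_val w x"
  unfolding word_val_def word_phase_def
  by (cases w) (simp add: letter_val_diag_op[OF assms] mult_ac)

lemma word_phase_pow_8:
  assumes "d \<in> clifford_phases r"
  shows "word_phase d w ^ 8 = 1"
proof -
  have "letter_phase d s ^ 8 = 1" for s
    using clifford_phases_pow_8[OF assms]
    by (cases s) (simp add: letter_phase_def flip: complex_cnj_power)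
  then show ?thesis by (cases w) (simp add: word_phase_def power_mult_distrib)
qed

text \<open>The product is a power of \<open>\<i>\<close> with exponent
  \<open>p + q - s - t\<close>, bits read as integers. The exponent lies between -2 and 2, so it is
  zero and the two multisets of bits coincide.\<close>

lemma phase_balance:
  fixes p q s t :: bit
  assumes "(if p = 1 then \<i> else 1) * (if q = 1 then \<i> else 1) *
    cnj (if s = 1 then \<i> else 1) * cnj (if t = 1 then \<i> else 1) = 1"
  shows "p = s \<and> q = t \<or> p = t \<and> q = s"
  using assms
  by (cases p; cases q; cases s; cases t) (simp_all add: complex_eq_iff)

text \<open>The primed bits come from a reference qubit where the two strings differ. A straight
  match of the parities cancels them and gives \<open>p = s\<close>; a crossed one excludes
  \<open>p = t\<close>, so the match of the bits is straight too.\<close>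

lemma bit_match:
  fixes p q s t p' q' s' t' :: bit
  assumes "p = s \<and> q = t \<or> p = t \<and> q = s"
    and "p + p' = s + s' \<and> q + q' = t + t' \<or> p + p' = t + t' \<and> q + q' = s + s'"
    and "p' = s'" "q' = t'" "p' \<noteq> q'"
  shows "p = s \<and> q = t"
  using assms by (cases p; cases q; cases s; cases t; cases p'; cases q') simp_all

text \<open>The single-qubit phases match the pairs qubit by qubit, and the parity phases force the same
  matching at all qubits.\<close>

lemma balanced_bits:
  assumes bits: "a \<in> bits r" "b \<in> bits r" "c \<in> bits r" "e \<in> bits r"
    and d: "\<And>d. d \<in> clifford_phases r \<Longrightarrow> d a * d b * cnj (d c) * cnj (d e) = 1"
  shows "a = c \<and> b = e \<or> a = e \<and> b = c"
proof -
  have z: "a k = 0" "b k = 0" "c k = 0" "e k = 0" if "\<not> k < r" for k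
    using bits that by (auto simp: bits_def)
  have one: "a k = c k \<and> b k = e k \<or> a k = e k \<and> b k = c k" for k
  proof (cases "k < r")
    case True
    then have "(\<lambda>a. if a k = 1 then \<i> else 1) \<in> clifford_phases r"
      unfolding clifford_phases_def by blast
    from d[OF this] show ?thesis by (rule phase_balance)
  qed (use z in auto)
  have two: "a j + a k = c j + c k \<and> b j + b k = e j + e k \<or>
      a j + a k = e j + e k \<and> b j + b k = c j + c k" if jk: "j \<noteq> k" for j k
  proof (cases "j < r \<and> k < r")
    case True
    then have "(\<lambda>a. if a j + a k = 1 then \<i> else 1) \<in> clifford_phases r"
      using jk unfolding clifford_phases_def by blast
    from d[OF this] show ?thesis by (rule phase_balance)
  next
    case False
    \<comment> \<open>At an index beyond \<open>r\<close> all four bits are zero, so the parity is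
      just the bit at the other index.\<close>
    then consider "\<not> j < r" | "\<not> k < r" by blast
    then show ?thesis
    proof cases
      case 1
      show ?thesis unfolding z[OF 1] add_0_left by (rule one)
    next
      case 2
      show ?thesis unfolding z[OF 2] add_0_right by (rule one)
    qed
  qed
  show ?thesis
  proof (cases "a = b")
    case True
    with one have "c k = a k" "e k = a k" for k by metis+
    then have "c = a" "e = a" by (simp_all add: fun_eq_iff)
    with True show ?thesis by simp
  next
    case False
    \<comment> \<open>This reference qubit decides between straight and crossed for all other
      qubits.\<close>
    then obtain k where k: "a k \<noteq> b k" by (auto simp: fun_eq_iff)
    from one[of k] show ?thesis
    proof
      assume k': "a k = c k \<and> b k = e k"
      have "a j = c j \<and> b j = e j" for j
      proof (cases "j = k")
        case False
        show ?thesis by (rule bit_match[OF one two[OF False]]) (use k k' in simp_all)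
      qed (use k' in simp)
      then show ?thesis by (simp add: fun_eq_iff)
    next
      assume k': "a k = e k \<and> b k = c k"
      have "a j = e j \<and> b j = c j" for j
      proof (cases "j = k")
        case False
        show ?thesis
          by (rule bit_match[OF one[THEN disj_commute[THEN iffD1]] two[OF False, THEN disj_commute[THEN iffD1]]])
            (use k k' in simp_all)
      qed (use k' in simp)
      then show ?thesis by (simp add: fun_eq_iff)
    qed
  qed
qed

section \<open>Biquadratic monomials in the values at two basis states\<close>

type_synonym bilabel = "2 \<times> 2 \<times> 2 \<times> 2"

text \<open>The label is ordered by site: each plain index is followed by its conjugated partner at
  the same site.\<close>

definition bimon :: "bilabel \<Rightarrow> (2 \<Rightarrow> complex) \<Rightarrow> (2 \<Rightarrow> complex) \<Rightarrow> complex"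
  where "bimon q v w = (case q of (i, k, j, l) \<Rightarrow> (v i * cnj (v k)) * (w j * cnj (w l)))"

text \<open>The transposed view of \<open>x\<close>: its two copies read at one basis state, as a
  vector with two entries.\<close>

definition site :: "'i pairvec \<Rightarrow> 'i \<Rightarrow> 2 \<Rightarrow> complex"
  where "site x a = (\<lambda>i. component x i a)"

lemma balanced_monomial:
  assumes "a \<in> bits r" "b \<in> bits r" "c \<in> bits r" "e \<in> bits r"
    and "\<And>d. d \<in> clifford_phases r \<Longrightarrow> d a * d b * cnj (d c) * cnj (d e) = 1"
  shows "\<exists>a'\<in>bits r. \<exists>b'\<in>bits r. \<exists>q. \<forall>x.
    component x i a * component x j b * cnj (component x k c) * cnj (component x l e) =
    bimon q (site x a') (site x b')"
  using balanced_bits[OF assms]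
proof
  assume "a = c \<and> b = e"
  then have "component x i a * component x j b * cnj (component x k c) * cnj (component x l e) =
      bimon (i, k, j, l) (site x a) (site x b)" for x
    by (simp add: bimon_def site_def)
  then show ?thesis using assms(1,2) by blast
next
  assume "a = e \<and> b = c"
  then have "component x i a * component x j b * cnj (component x k c) * cnj (component x l e) =
      bimon (i, l, j, k) (site x a) (site x b)" for x
    by (simp add: bimon_def site_def)
  then show ?thesis using assms(1,2) by blast
qed

text \<open>The product is \<open>omega\<close> raised to the number of plain minus conjugated
  letters, which is one of -4, -2, 0, 2, 4. As \<open>omega\<close> has order 8, the exponent is 0;
  the set lists the six placements of two conjugates.\<close>

lemma omega_balance:
  assumes "(if e1 then cnj omega else omega) * (if e2 then cnj omega else omega) *
    (if e3 then cnj omega else omega) * (if e4 then cnj omega else omega) = 1"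
  shows "(e1, e2, e3, e4) \<in> {(False, False, True, True), (False, True, False, True),
    (False, True, True, False), (True, False, False, True), (True, False, True, False),
    (True, True, False, False)}"
proof -
  define o' where "o' e = (if e then cnj omega else omega)" for e
  have 1: "omega * cnj omega = 1"
    using complex_norm_square[of omega] cmod_omega by simp
  have 2: "cnj omega * cnj omega = - \<i>"
    using omega_sq by (metis complex_cnj_i complex_cnj_mult)
  have pair: "o' e * o' f = (if e = f then if e then - \<i> else \<i> else 1)" for e f
    unfolding o'_def using 1 2 omega_sq mult.commute[of "cnj omega" omega] by (cases e; cases f) (simp_all only: if_True if_False simp_thms)
  have "(o' e1 * o' e2) * (o' e3 * o' e4) = 1"
    using assms unfolding o'_def by (simp only: mult.assoc)
  then show ?thesis
    unfolding pair by (cases e1; cases e2; cases e3; cases e4) (simp_all add: complex_eq_iff)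
qed

text \<open>Each of the six placements left by the scalar phase is reordered with the plain letters
  first, and the remaining phases then pair the indices.\<close>

lemma fixed_word:
  assumes w: "w \<in> words4 (bits r)" and d: "\<And>d. d \<in> clifford_phases r \<Longrightarrow> word_phase d w = 1"
  shows "\<exists>a\<in>bits r. \<exists>b\<in>bits r. \<exists>q. \<forall>x. word_val w x = bimon q (site x a) (site x b)"
proof -
  obtain e1 i1 a1 e2 i2 a2 e3 i3 a3 e4 i4 a4 where
    w_eq: "w = ((e1, i1, a1), (e2, i2, a2), (e3, i3, a3), (e4, i4, a4))"
    by (metis prod.exhaust)
  have bits: "a1 \<in> bits r" "a2 \<in> bits r" "a3 \<in> bits r" "a4 \<in> bits r"
    using w by (simp_all add: w_eq)
  have ph: "letter_phase d (e1, i1, a1) * letter_phase d (e2, i2, a2) *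
      letter_phase d (e3, i3, a3) * letter_phase d (e4, i4, a4) = 1" if "d \<in> clifford_phases r" for d
    using d[OF that] by (simp add: w_eq word_phase_def)
  have "(\<lambda>_. omega) \<in> clifford_phases r" unfolding clifford_phases_def by blast
  from ph[OF this] have "(e1, e2, e3, e4) \<in> {(False, False, True, True), (False, True, False, True),
    (False, True, True, False), (True, False, False, True), (True, False, True, False),
    (True, True, False, False)}"
    unfolding letter_phase_def prod.case by (rule omega_balance)
  then consider
      "\<not> e1" "\<not> e2" e3 e4 | "\<not> e1" e2 "\<not> e3" e4 | "\<not> e1" e2 e3 "\<not> e4"
    | e1 "\<not> e2" "\<not> e3" e4 | e1 "\<not> e2" e3 "\<not> e4" | e1 e2 "\<not> e3" "\<not> e4"
    by auto
  then show ?thesis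
  proof cases
    case 1
    have "d a1 * d a2 * cnj (d a3) * cnj (d a4) = 1" if "d \<in> clifford_phases r" for d
      using ph[OF that] 1 by (simp add: letter_phase_def mult_ac)
    from balanced_monomial[OF bits(1,2,3,4) this, of i1 i2 i3 i4] show ?thesis
      using 1 by (simp add: w_eq word_val_def letter_val_def mult_ac)
  next
    case 2
    have "d a1 * d a3 * cnj (d a2) * cnj (d a4) = 1" if "d \<in> clifford_phases r" for d
      using ph[OF that] 2 by (simp add: letter_phase_def mult_ac)
    from balanced_monomial[OF bits(1,3,2,4) this, of i1 i3 i2 i4] show ?thesis
      using 2 by (simp add: w_eq word_val_def letter_val_def mult_ac)
  next
    case 3
    have "d a1 * d a4 * cnj (d a2) * cnj (d a3) = 1" if "d \<in> clifford_phases r" for d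
      using ph[OF that] 3 by (simp add: letter_phase_def mult_ac)
    from balanced_monomial[OF bits(1,4,2,3) this, of i1 i4 i2 i3] show ?thesis
      using 3 by (simp add: w_eq word_val_def letter_val_def mult_ac)
  next
    case 4
    have "d a2 * d a3 * cnj (d a1) * cnj (d a4) = 1" if "d \<in> clifford_phases r" for d
      using ph[OF that] 4 by (simp add: letter_phase_def mult_ac)
    from balanced_monomial[OF bits(2,3,1,4) this, of i2 i3 i1 i4] show ?thesis
      using 4 by (simp add: w_eq word_val_def letter_val_def mult_ac)
  next
    case 5
    have "d a2 * d a4 * cnj (d a1) * cnj (d a3) = 1" if "d \<in> clifford_phases r" for d
      using ph[OF that] 5 by (simp add: letter_phase_def mult_ac)
    from balanced_monomial[OF bits(2,4,1,3) this, of i2 i4 i1 i3] show ?thesis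
      using 5 by (simp add: w_eq word_val_def letter_val_def mult_ac)
  next
    case 6
    have "d a3 * d a4 * cnj (d a1) * cnj (d a2) = 1" if "d \<in> clifford_phases r" for d
      using ph[OF that] 6 by (simp add: letter_phase_def mult_ac)
    from balanced_monomial[OF bits(3,4,1,2) this, of i3 i4 i1 i2] show ?thesis
      using 6 by (simp add: w_eq word_val_def letter_val_def mult_ac)
  qed
qed

definition biform :: "(bilabel \<Rightarrow> complex) \<Rightarrow> (2 \<Rightarrow> complex) \<Rightarrow> (2 \<Rightarrow> complex) \<Rightarrow> complex"
  where "biform \<kappa> v w = (\<Sum>q\<in>UNIV. \<kappa> q * bimon q v w)"

lemma invariant_pair_expansion:
  assumes f: "f \<in> Sym4_inv (bits r) (Cliff r)"
  shows "\<exists>\<kappa>. \<forall>x\<in>V_space (bits r). complex_of_real (f x) =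
    (\<Sum>a\<in>bits r. \<Sum>b\<in>bits r. biform (\<kappa> a b) (site x a) (site x b))"
proof -
  let ?V = "V_space (bits r)" and ?W = "words4 (bits r)"
  let ?D = "\<lambda>d. map_prod (diag_op (bits r) d) (diag_op (bits r) d)"
  have inv: "f (map_prod g g x) = f x" if "g \<in> Cliff r" "x \<in> ?V" for g x
    using f that by (simp add: Sym4_inv_def)
  have f4: "f \<in> Sym4 (bits r)" using f by (simp add: Sym4_inv_def)
  obtain c where c: "\<forall>x\<in>?V. complex_of_real (f x) = (\<Sum>w\<in>?W. c w * word_val w x)"
    using Sym4_expand[OF finite_bits f4] ..
  define T where "T = {w \<in> ?W. \<forall>d\<in>clifford_phases r. word_phase d w = 1}"
  have fin: "finite ?W" by simp
  have fT: "complex_of_real (f x) = (\<Sum>w\<in>T. c w * word_val w x)" if x: "x \<in> ?V" for x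
    unfolding T_def
  \<comment> \<open>The value 8 works because all phases, hence all word weights, are eighth roots
    of unity.\<close>
  proof (rule invariant_eigen_expansion_family[OF finite_clifford_phases[of r], where V = ?V and g = ?D and n = 8])
    show "?D d x \<in> ?V" if "x \<in> ?V" for d x
      using that by (auto simp: V_space_def)
    show "complex_of_real (f (?D d x)) = complex_of_real (f x)" if "d \<in> clifford_phases r" "x \<in> ?V" for d x
      using inv[OF clifford_phases_in_Cliff[OF that(1)] that(2)] by simp
    show "word_val w (?D d x) = word_phase d w * word_val w x" if "x \<in> ?V" for d w x
      by (rule word_val_diag_op[OF that])
    show "word_phase d w ^ 8 = 1" if "d \<in> clifford_phases r" for d w
      by (rule word_phase_pow_8[OF that])
    show "complex_of_real (f x) = (\<Sum>w\<in>?W. c w * word_val w x)" if "x \<in> ?V" for x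
      using c that by blast
  qed (simp, rule fin, rule x)
  have "\<exists>y. fst y \<in> bits r \<and> fst (snd y) \<in> bits r \<and>
      (\<forall>x. word_val w x = bimon (snd (snd y)) (site x (fst y)) (site x (fst (snd y))))" if "w \<in> T" for w
  proof -
    have "w \<in> ?W" "\<And>d. d \<in> clifford_phases r \<Longrightarrow> word_phase d w = 1"
      using that unfolding T_def by blast+
    from fixed_word[OF this] obtain a b q where
      "a \<in> bits r" "b \<in> bits r" "\<forall>x. word_val w x = bimon q (site x a) (site x b)" by blast
    then show ?thesis by (intro exI[of _ "(a, b, q)"]) simp
  qed
  then obtain h where h: "\<And>w. w \<in> T \<Longrightarrow> fst (h w) \<in> bits r \<and> fst (snd (h w)) \<in> bits r \<and>
      (\<forall>x. word_val w x = bimon (snd (snd (h w))) (site x (fst (h w))) (site x (fst (snd (h w)))))"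
    by metis
  \<comment> \<open>\<open>h\<close> picks one label for each surviving word, and the coefficients
    of words with equal label are added; labels never picked receive the empty sum.\<close>
  define \<kappa> where "\<kappa> a b q = (\<Sum>w\<in>{w \<in> T. h w = (a, b, q)}. c w)" for a b q
  have finT: "finite T" unfolding T_def using fin by (rule finite_subset[rotated]) blast
  have "complex_of_real (f x) = (\<Sum>a\<in>bits r. \<Sum>b\<in>bits r. biform (\<kappa> a b) (site x a) (site x b))"
    if x: "x \<in> ?V" for x
  proof -
    let ?Y = "bits r \<times> bits r \<times> (UNIV :: bilabel set)"
    let ?M = "\<lambda>y. bimon (snd (snd y)) (site x (fst y)) (site x (fst (snd y)))"
    have hY: "h ` T \<subseteq> ?Y" using h by (intro image_subsetI) (simp only: mem_Times_iff UNIV_I simp_thms)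
    have "complex_of_real (f x) = (\<Sum>w\<in>T. c w * ?M (h w))"
      unfolding fT[OF x] by (rule sum.cong[OF refl]) (simp add: h)
    also have "\<dots> = (\<Sum>y\<in>?Y. \<Sum>w\<in>{w \<in> T. h w = y}. c w * ?M (h w))"
      by (rule sum.group[OF finT _ hY, symmetric]) simp
    also have "\<dots> = (\<Sum>y\<in>?Y. \<kappa> (fst y) (fst (snd y)) (snd (snd y)) * ?M y)"
    proof (rule sum.cong[OF refl])
      fix y
      have "(\<Sum>w\<in>{w \<in> T. h w = y}. c w * ?M (h w)) = (\<Sum>w\<in>{w \<in> T. h w = y}. c w * ?M y)"
        by (rule sum.cong[OF refl]) (simp only: mem_Collect_eq)
      then show "(\<Sum>w\<in>{w \<in> T. h w = y}. c w * ?M (h w)) = \<kappa> (fst y) (fst (snd y)) (snd (snd y)) * ?M y"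
        by (simp only: \<kappa>_def sum_distrib_right prod.collapse)
    qed
    also have "\<dots> = (\<Sum>a\<in>bits r. \<Sum>b\<in>bits r. biform (\<kappa> a b) (site x a) (site x b))"
      by (simp only: biform_def sum.cartesian_product case_prod_unfold)
    finally show ?thesis .
  qed
  then show ?thesis by blast
qed

section \<open>Invariant quartics are quadratic in the Gram matrix\<close>

text \<open>Test vectors that isolate the contribution of one pair of basis states to the double
  sum.\<close>

definition two_sites :: "'i \<Rightarrow> (2 \<Rightarrow> complex) \<Rightarrow> 'i \<Rightarrow> (2 \<Rightarrow> complex) \<Rightarrow> 'i pairvec"
  where "two_sites a v b w =
    (\<lambda>c. if c = a then v 1 else if c = b then w 1 else 0, \<lambda>c. if c = a then v 2 else if c = b then w 2 else 0)"

lemma site_two_sites: "site (two_sites a v b w) c = (if c = a then v else if c = b then w else (\<lambda>_. 0))"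
proof
  fix i :: 2
  show "site (two_sites a v b w) c i = (if c = a then v else if c = b then w else (\<lambda>_. 0)) i"
    using exhaust_2[of i] by (auto simp: site_def component_def two_sites_def)
qed

lemma two_sites_in_V_space: "a \<in> I \<Longrightarrow> b \<in> I \<Longrightarrow> two_sites a v b w \<in> V_space I"
  by (auto simp: two_sites_def V_space_def hspace_def)

lemma pairvec_eqI: "(\<And>c. site x c = site y c) \<Longrightarrow> x = y"
proof -
  assume "\<And>c. site x c = site y c"
  then have "component x i c = component y i c" for i c by (simp add: site_def fun_eq_iff)
  from this[of 1] this[of 2] have "fst x = fst y" "snd x = snd y"
    by (auto simp: component_def fun_eq_iff)
  then show "x = y" by (simp add: prod_eq_iff)
qed

lemma site_perm_op:
  assumes "x \<in> V_space I"
  shows "site (map_prod (perm_op I p) (perm_op I p) x) a = site x (p a)"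
  using component_in_hspace[OF assms] by (simp add: site_def component_map_prod perm_op_apply)

text \<open>Pull-back moves the support from \<open>p a\<close>, \<open>p b\<close> to
  \<open>a\<close>, \<open>b\<close>.\<close>

lemma perm_op_two_sites:
  assumes "inj p" "p a \<in> I" "p b \<in> I"
  shows "map_prod (perm_op I p) (perm_op I p) (two_sites (p a) v (p b) w) = two_sites a v b w"
proof (rule pairvec_eqI)
  fix c
  show "site (map_prod (perm_op I p) (perm_op I p) (two_sites (p a) v (p b) w)) c = site (two_sites a v b w) c"
    using assms by (simp add: site_perm_op two_sites_in_V_space site_two_sites inj_eq)
qed

lemma bimon_zero [simp]: "bimon q (\<lambda>_. 0) w = 0" "bimon q v (\<lambda>_. 0) = 0"
  by (cases q; simp add: bimon_def)+

lemma biform_zero [simp]: "biform \<kappa> (\<lambda>_. 0) w = 0" "biform \<kappa> v (\<lambda>_. 0) = 0"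
  by (simp_all add: biform_def)

text \<open>Each of the two arguments enters once plainly and once conjugated.\<close>

lemma biform_scale: "biform \<kappa> (\<lambda>i. z * v i) (\<lambda>i. z * w i) = (z * cnj z)\<^sup>2 * biform \<kappa> v w"
proof -
  have "bimon q (\<lambda>i. z * v i) (\<lambda>i. z * w i) = (z * cnj z)\<^sup>2 * bimon q v w" for q
    by (cases q) (simp add: bimon_def power2_eq_square mult_ac)
  then show ?thesis by (simp add: biform_def sum_distrib_left mult_ac)
qed

lemma sum_biform_two_sites:
  assumes "finite I" "a \<in> I" "b \<in> I" "a \<noteq> b"
  shows "(\<Sum>c\<in>I. \<Sum>d\<in>I. biform (\<kappa> c d) (site (two_sites a v b w) c) (site (two_sites a v b w) d)) =
    biform (\<kappa> a a) v v + biform (\<kappa> b b) w w + (biform (\<kappa> a b) v w + biform (\<kappa> b a) w v)"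
proof -
  let ?s = "site (two_sites a v b w)"
  have z: "?s c = (\<lambda>_. 0)" if "c \<notin> {a, b}" for c using that by (simp add: site_two_sites)
  have "(\<Sum>c\<in>I. \<Sum>d\<in>I. biform (\<kappa> c d) (?s c) (?s d)) = (\<Sum>c\<in>{a, b}. \<Sum>d\<in>I. biform (\<kappa> c d) (?s c) (?s d))"
    by (rule sum.mono_neutral_right) (use assms z in auto)
  also have "\<dots> = (\<Sum>c\<in>{a, b}. \<Sum>d\<in>{a, b}. biform (\<kappa> c d) (?s c) (?s d))"
    by (intro sum.cong[OF refl] sum.mono_neutral_right) (use assms z in auto)
  also have "\<dots> = biform (\<kappa> a a) v v + biform (\<kappa> b b) w w + (biform (\<kappa> a b) v w + biform (\<kappa> b a) w v)"
    using assms by (simp add: site_two_sites)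
  finally show ?thesis .
qed

lemma herm_Cliff:
  assumes "g \<in> Cliff r" "y \<in> hspace (bits r)" "z \<in> hspace (bits r)"
  shows "herm (bits r) (g y) (g z) = herm (bits r) y z"
proof -
  have "g \<in> carrier (unitary_group (bits r))" using Cliff_unitary assms by blast
  then show ?thesis using assms by (simp add: unitary_group_def)
qed

lemma Cliff_in_hspace:
  assumes "g \<in> Cliff r" "y \<in> hspace (bits r)"
  shows "g y \<in> hspace (bits r)"
  using Cliff_unitary assms unitary_in_hspace by blast

lemma Cliff_in_V_space: "g \<in> Cliff r \<Longrightarrow> x \<in> V_space (bits r) \<Longrightarrow> map_prod g g x \<in> V_space (bits r)"
  by (auto simp: V_space_def intro: Cliff_in_hspace)

text \<open>The index order \<open>k\<close>, \<open>i\<close> is reversed because the Hermitian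
  form conjugates its first variable.\<close>

definition gram_form :: "'i set \<Rightarrow> (bilabel \<Rightarrow> complex) \<Rightarrow> 'i pairvec \<Rightarrow> complex"
  where "gram_form I \<kappa> x = (\<Sum>q\<in>UNIV. \<kappa> q * (case q of (i, k, j, l) \<Rightarrow> gram I x $ k $ i * gram I x $ l $ j))"

lemma gram_Cliff:
  "g \<in> Cliff r \<Longrightarrow> x \<in> V_space (bits r) \<Longrightarrow> gram (bits r) (map_prod g g x) = gram (bits r) x"
  by (simp add: gram_def component_map_prod herm_Cliff component_in_hspace)

text \<open>With coefficients independent of the sites, the double sum of each monomial factors into
  two single sums, each an entry of the Gram matrix.\<close>

lemma sum_biform_eq_gram_form:
  "(\<Sum>a\<in>I. \<Sum>b\<in>I. biform \<kappa> (site x a) (site x b)) = gram_form I \<kappa> x"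
proof -
  have "(\<Sum>a\<in>I. \<Sum>b\<in>I. bimon q (site x a) (site x b)) =
      (case q of (i, k, j, l) \<Rightarrow> gram I x $ k $ i * gram I x $ l $ j)" for q
    by (cases q) (simp add: bimon_def site_def gram_def herm_def sum_product mult_ac)
  moreover have "(\<Sum>a\<in>I. \<Sum>b\<in>I. biform \<kappa> (site x a) (site x b)) =
      (\<Sum>q\<in>UNIV. \<kappa> q * (\<Sum>a\<in>I. \<Sum>b\<in>I. bimon q (site x a) (site x b)))"
  proof -
    have "(\<Sum>a\<in>I. \<Sum>b\<in>I. biform \<kappa> (site x a) (site x b)) =
        (\<Sum>a\<in>I. \<Sum>q\<in>UNIV. \<Sum>b\<in>I. \<kappa> q * bimon q (site x a) (site x b))"
      unfolding biform_def by (rule sum.cong[OF refl]) (rule sum.swap)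
    also have "\<dots> = (\<Sum>q\<in>UNIV. \<Sum>a\<in>I. \<Sum>b\<in>I. \<kappa> q * bimon q (site x a) (site x b))"
      by (rule sum.swap)
    finally show ?thesis by (simp only: sum_distrib_left)
  qed
  ultimately show ?thesis by (simp add: gram_form_def)
qed

text \<open>On a vector supported at a single site the Hadamard gate multiplies the sum by
  \<open>2 / (sqrt 2)^4\<close>.\<close>

lemma site_sum_hadamard_zero:
  fixes u :: "(2 \<Rightarrow> complex) \<Rightarrow> complex"
  assumes r: "r \<ge> 1" and u0: "u (\<lambda>_. 0) = 0"
    and hom: "\<And>v. u (\<lambda>i. v i / of_real (sqrt 2)) = u v / 4"
    and inv: "\<And>x. x \<in> V_space (bits r) \<Longrightarrow>
      (\<Sum>a\<in>bits r. u (site (map_prod (had_op r 0) (had_op r 0) x) a)) = (\<Sum>a\<in>bits r. u (site x a))"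
  shows "u v = 0"
proof -
  let ?o = "\<lambda>_. 0 :: bit"
  have bits: "?o \<in> bits r" "flip 0 ?o \<in> bits r" using r by simp_all
  let ?x = "two_sites ?o v (flip 0 ?o) (\<lambda>_. 0)" and ?H = "map_prod (had_op r 0) (had_op r 0)"
  have x: "?x \<in> V_space (bits r)" using bits by (rule two_sites_in_V_space)
  have sx: "site ?x a = (if a = ?o then v else (\<lambda>_. 0))" for a
    by (simp add: site_two_sites)
  have had: "site (?H ?x) a i =
      ((if a 0 = 1 then -1 else 1) * site ?x a i + site ?x (flip 0 a) i) / complex_of_real (sqrt 2)" for a i
    by (simp add: site_def component_map_prod had_op_apply[OF component_in_hspace[OF x]])
  have flip0: "flip 0 a = ?o \<longleftrightarrow> a = flip 0 ?o" for a by (metis flip_flip)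
  \<comment> \<open>The minus sign of the gate meets the zero value at \<open>flip 0 ?o\<close>, so
    both sites of the image carry the same vector.\<close>
  have sH: "site (?H ?x) a = (if a \<in> {?o, flip 0 ?o} then (\<lambda>i. v i / of_real (sqrt 2)) else (\<lambda>_. 0))" for a
  proof
    fix i
    consider "a = ?o" | "a = flip 0 ?o" | "a \<notin> {?o, flip 0 ?o}" by blast
    then show "site (?H ?x) a i = (if a \<in> {?o, flip 0 ?o} then (\<lambda>i. v i / of_real (sqrt 2)) else (\<lambda>_. 0)) i"
    proof cases
      case 1
      then show ?thesis unfolding had sx by simp
    next
      case 2
      then show ?thesis unfolding had sx by simp
    next
      case 3
      then have "a \<noteq> ?o" "flip 0 a \<noteq> ?o" using flip0 by auto
      then have "site (?H ?x) a i = 0" unfolding had sx by (simp only: if_False) simp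
      then show ?thesis using 3 by (simp only: if_False)
    qed
  qed
  have "(\<Sum>a\<in>bits r. u (site ?x a)) = (\<Sum>a\<in>{?o}. u (site ?x a))"
    by (rule sum.mono_neutral_right) (use bits u0 in \<open>simp_all add: sx\<close>)
  moreover have "(\<Sum>a\<in>bits r. u (site (?H ?x) a)) = (\<Sum>a\<in>{?o, flip 0 ?o}. u (site (?H ?x) a))"
    by (rule sum.mono_neutral_right) (use bits u0 in \<open>simp_all add: sH\<close>)
  ultimately have "u v / 4 + u v / 4 = u v"
    using inv[OF x] by (simp add: sx sH hom)
  then show ?thesis by simp
qed

text \<open>Test vectors determine only the diagonal values of the forms and the sum of the two
  orders of a pair. Adding the double sum to its transpose involves nothing else, at the price of
  the factor 2.\<close>

lemma invariant_eq_gram_form: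
  assumes r: "r \<ge> 1" and f: "f \<in> Sym4_inv (bits r) (Cliff r)"
  shows "\<exists>\<kappa>. \<forall>x\<in>V_space (bits r). 2 * complex_of_real (f x) = gram_form (bits r) \<kappa> x"
proof -
  let ?I = "bits r" and ?V = "V_space (bits r)" and ?o = "\<lambda>_. 0 :: bit" and ?e = "flip 0 (\<lambda>_. 0)"
  have inv: "f (map_prod g g x) = f x" if "g \<in> Cliff r" "x \<in> ?V" for g x
    using f that by (simp add: Sym4_inv_def)
  obtain \<kappa> where \<kappa>: "\<And>x. x \<in> ?V \<Longrightarrow> complex_of_real (f x) =
      (\<Sum>a\<in>?I. \<Sum>b\<in>?I. biform (\<kappa> a b) (site x a) (site x b))"
    using invariant_pair_expansion[OF f] by blast
  have o: "?o \<in> ?I" and e: "?e \<in> ?I" using r by simp_all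
  have two: "complex_of_real (f (two_sites a v b w)) =
      biform (\<kappa> a a) v v + biform (\<kappa> b b) w w + (biform (\<kappa> a b) v w + biform (\<kappa> b a) w v)"
    if "a \<in> ?I" "b \<in> ?I" "a \<noteq> b" for a b v w
    using \<kappa>[OF two_sites_in_V_space[OF that(1,2)]] sum_biform_two_sites[OF finite_bits that, of \<kappa> v w] by (rule trans)
  have move: "f (two_sites a v b w) = f (two_sites ?o v ?e w)"
    if ab: "a \<in> ?I" "b \<in> ?I" "a \<noteq> b" for a b v w
  proof -
    obtain p where p: "p \<in> clifford_perms r" "p a = ?o" "p b = ?e"
      using clifford_perms_two_transitive[OF r ab] by blast
    then have "inj p" "perm_op ?I p \<in> Cliff r" by (simp_all add: clifford_perms_def bij_is_inj)
    with perm_op_two_sites[of p a ?I b v w] inv[of "perm_op ?I p" "two_sites ?o v ?e w"]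
    show ?thesis using p o e by (simp add: two_sites_in_V_space)
  qed
  \<comment> \<open>A zero vector at the second site kills all terms but the diagonal one;
    \<open>flip 0 a\<close> serves as that site.\<close>
  have diag: "biform (\<kappa> a a) v v = biform (\<kappa> ?o ?o) v v" if a: "a \<in> ?I" for a v
  proof -
    have "flip 0 a \<in> ?I" "a \<noteq> flip 0 a" using a r by simp_all
    from move[OF a this, of v "\<lambda>_. 0"] two[OF a this, of v "\<lambda>_. 0"] two[OF o e, of v "\<lambda>_. 0"]
    show ?thesis by simp
  qed
  define K where "K v w = biform (\<kappa> ?o ?e) v w + biform (\<kappa> ?e ?o) w v" for v w
  have off: "biform (\<kappa> a b) v w + biform (\<kappa> b a) w v = K v w"
    if ab: "a \<in> ?I" "b \<in> ?I" "a \<noteq> b" for a b v w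
    using move[OF ab, of v w] two[OF ab, of v w] two[OF o e, of v w] diag[OF ab(1), of v] diag[OF ab(2), of w] diag[OF e, of w]
    by (simp add: K_def)
  \<comment> \<open>The error made on the diagonal when \<open>K\<close> is used for equal sites as
    well.\<close>
  define u where "u v = 2 * biform (\<kappa> ?o ?o) v v - K v v" for v
  \<comment> \<open>In the sum over all pairs the reversed term of \<open>K\<close> may be
    relabelled, so both coefficient families simply add.\<close>
  define \<kappa>' where "\<kappa>' q = \<kappa> ?o ?e q + \<kappa> ?e ?o q" for q
  have K_sum: "(\<Sum>a\<in>?I. \<Sum>b\<in>?I. K (site x a) (site x b)) = gram_form ?I \<kappa>' x" for x
  proof -
    have "(\<Sum>a\<in>?I. \<Sum>b\<in>?I. K (site x a) (site x b)) =
        (\<Sum>a\<in>?I. \<Sum>b\<in>?I. biform (\<kappa> ?o ?e) (site x a) (site x b)) +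
        (\<Sum>a\<in>?I. \<Sum>b\<in>?I. biform (\<kappa> ?e ?o) (site x b) (site x a))"
      unfolding K_def sum.distrib ..
    also have "(\<Sum>a\<in>?I. \<Sum>b\<in>?I. biform (\<kappa> ?e ?o) (site x b) (site x a)) =
        (\<Sum>a\<in>?I. \<Sum>b\<in>?I. biform (\<kappa> ?e ?o) (site x a) (site x b))"
      by (rule sum.swap)
    finally show ?thesis
      unfolding sum_biform_eq_gram_form by (simp add: gram_form_def \<kappa>'_def distrib_right sum.distrib)
  qed
  have split: "2 * complex_of_real (f x) = gram_form ?I \<kappa>' x + (\<Sum>a\<in>?I. u (site x a))" if x: "x \<in> ?V" for x
  proof -
    have pt: "biform (\<kappa> a b) (site x a) (site x b) + biform (\<kappa> b a) (site x b) (site x a) =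
        K (site x a) (site x b) + (if a = b then u (site x a) else 0)"
      if "a \<in> ?I" "b \<in> ?I" for a b
    proof (cases "a = b")
      case True
      then show ?thesis using diag[OF that(1), of "site x a"] by (simp add: u_def)
    next
      case False
      then show ?thesis using off[OF that False] by simp
    qed
    have "2 * complex_of_real (f x) = (\<Sum>a\<in>?I. \<Sum>b\<in>?I. biform (\<kappa> a b) (site x a) (site x b)) +
        (\<Sum>a\<in>?I. \<Sum>b\<in>?I. biform (\<kappa> b a) (site x b) (site x a))"
      unfolding sum.swap[of "\<lambda>a b. biform (\<kappa> b a) (site x b) (site x a)"] using \<kappa>[OF x] by simp
    also have "\<dots> = (\<Sum>a\<in>?I. \<Sum>b\<in>?I. K (site x a) (site x b) + (if a = b then u (site x a) else 0))"
      unfolding sum.distrib[symmetric] by (intro sum.cong[OF refl] pt)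
    also have "\<dots> = gram_form ?I \<kappa>' x + (\<Sum>a\<in>?I. u (site x a))"
      unfolding sum.distrib K_sum by simp
    finally show ?thesis .
  qed
  have "u v = 0" for v
  proof (rule site_sum_hadamard_zero[OF r, where u = u])
    show "u (\<lambda>_. 0) = 0" by (simp add: u_def K_def)
    show "u (\<lambda>i. v i / of_real (sqrt 2)) = u v / 4" for v
    proof -
      let ?z = "1 / complex_of_real (sqrt 2)"
      have z: "(?z * cnj ?z)\<^sup>2 = 1 / 4"
        by (simp add: of_real_sqrt2_sq power2_eq_square)
      show ?thesis
        using biform_scale[of _ ?z v v, unfolded z] by (simp add: u_def K_def algebra_simps)
    qed
    fix x assume x: "x \<in> ?V"
    let ?H = "map_prod (had_op r 0) (had_op r 0)"
    have H: "had_op r 0 \<in> Cliff r" using r by (simp add: had_op_in_Cliff)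
    \<comment> \<open>The quartic and the Gram part are both invariant, hence so is their
      difference, the sum of \<open>u\<close> over sites.\<close>
    have "gram_form ?I \<kappa>' (?H x) = gram_form ?I \<kappa>' x"
      unfolding gram_form_def gram_Cliff[OF H x] ..
    with split[OF x] split[OF Cliff_in_V_space[OF H x]] inv[OF H x]
    show "(\<Sum>a\<in>?I. u (site (?H x) a)) = (\<Sum>a\<in>?I. u (site x a))" by simp
  qed
  with split show ?thesis by auto
qed

section \<open>Gram entries as quadratic forms \<open>gamma\<close>, and the inclusion in
  \<open>G4\<close>\<close>

lemma sum_fun_apply: "(\<Sum>a\<in>A. f a) x = (\<Sum>a\<in>A. f a x)"
  for f :: "'a \<Rightarrow> 'b \<Rightarrow> 'c::comm_monoid_add"
  by (induction A rule: infinite_finite_induct) simp_all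

lemma gram_cnj: "cnj (gram I x $ k $ i) = gram I x $ i $ k"
  by (simp add: gram_def herm_def mult.commute)

text \<open>\<open>B\<close> is the Hermitian part of the matrix unit \<open>E\<close> at position
  \<open>i\<close>, \<open>k\<close>, whose trace against a matrix reads off the entry
  \<open>k\<close>, \<open>i\<close>.\<close>

lemma gamma_Re_gram:
  obtains B where "B \<in> Herm2" "\<And>x. gamma I B x = (if x \<in> V_space I then Re (gram I x $ k $ i) else 0)"
proof
  let ?B = "(\<chi> p q. ((if p = i \<and> q = k then 1 else 0) + (if p = k \<and> q = i then 1 else 0)) / 2) :: complex^2^2"
  have ik: "i = 1 \<or> i = 2" "k = 1 \<or> k = 2" by (rule exhaust_2)+
  then show "?B \<in> Herm2"
    by (elim disjE) (simp_all add: Herm2_def forall_2)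
  have "Re (trace (?B ** gram I x)) = Re (gram I x $ k $ i)" for x
  proof -
    have c: "Re (gram I x $ 1 $ 2) = Re (gram I x $ 2 $ 1)"
      using arg_cong[OF gram_cnj[of I x 1 2], of Re] by simp
    from ik show ?thesis
      by (elim disjE) (simp_all add: trace_def matrix_matrix_mult_def sum_2 c)
  qed
  then show "gamma I ?B x = (if x \<in> V_space I then Re (gram I x $ k $ i) else 0)" for x
    by (simp add: gamma_def)
qed

text \<open>Here \<open>B\<close> is the difference of the same matrix unit and its adjoint, divided
  by \<open>2 * \<i>\<close>.\<close>

lemma gamma_Im_gram:
  obtains B where "B \<in> Herm2" "\<And>x. gamma I B x = (if x \<in> V_space I then Im (gram I x $ k $ i) else 0)"
proof
  let ?B = "(\<chi> p q. ((if p = k \<and> q = i then \<i> else 0) - (if p = i \<and> q = k then \<i> else 0)) / 2) :: complex^2^2"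
  have ik: "i = 1 \<or> i = 2" "k = 1 \<or> k = 2" by (rule exhaust_2)+
  then show "?B \<in> Herm2"
    by (elim disjE) (simp_all add: Herm2_def forall_2)
  have "Re (trace (?B ** gram I x)) = Im (gram I x $ k $ i)" for x
  proof -
    have c: "Im (gram I x $ 1 $ 2) = - Im (gram I x $ 2 $ 1)" "Im (gram I x $ l $ l) = 0" for l
      using arg_cong[OF gram_cnj[of I x 2 1], of Im] arg_cong[OF gram_cnj[of I x l l], of Im] by simp_all
    from ik show ?thesis
      by (elim disjE) (simp_all add: trace_def matrix_matrix_mult_def sum_2 c)
  qed
  then show "gamma I ?B x = (if x \<in> V_space I then Im (gram I x $ k $ i) else 0)" for x
    by (simp add: gamma_def)
qed

text \<open>Membership in \<open>G4\<close> concerns functions on the whole type, so values off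
  \<open>V_space I\<close> have to agree too.\<close>

lemma Sym4_outside:
  assumes "f \<in> Sym4 I" "x \<notin> V_space I"
  shows "f x = 0"
proof -
  have "subspace {f :: 'a pairvec \<Rightarrow> real. f x = 0}"
    by (simp add: subspace_def scaleR_fun_def)
  moreover have "f x = 0" if "f \<in> V_dual I" for f
    using that assms(2) unfolding V_dual_def by blast
  then have "{f1 * f2 * f3 * f4 | f1 f2 f3 f4.
    f1 \<in> V_dual I \<and> f2 \<in> V_dual I \<and> f3 \<in> V_dual I \<and> f4 \<in> V_dual I} \<subseteq> {f. f x = 0}"
    by auto
  ultimately have "Sym4 I \<subseteq> {f. f x = 0}"
    unfolding Sym4_def by (intro span_minimal)
  then show ?thesis using assms(1) by blast
qed

lemma Sym4_inv_subset_G4: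
  assumes r: "r \<ge> 1"
  shows "Sym4_inv (bits r) (Cliff r) \<subseteq> G4 (bits r)"
proof
  fix f assume f: "f \<in> Sym4_inv (bits r) (Cliff r)"
  let ?I = "bits r" and ?V = "V_space (bits r)"
  obtain \<kappa> where \<kappa>: "\<And>x. x \<in> ?V \<Longrightarrow> 2 * complex_of_real (f x) = gram_form ?I \<kappa> x"
    using invariant_eq_gram_form[OF r f] by blast
  have "\<exists>B. B \<in> Herm2 \<and> (\<forall>x. gamma ?I B x = (if x \<in> ?V then Re (gram ?I x $ k $ i) else 0))" for k i
    by (rule gamma_Re_gram) blast
  then obtain P where P: "\<And>k i. P k i \<in> Herm2"
    "\<And>k i x. gamma ?I (P k i) x = (if x \<in> ?V then Re (gram ?I x $ k $ i) else 0)"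
    by metis
  have "\<exists>B. B \<in> Herm2 \<and> (\<forall>x. gamma ?I B x = (if x \<in> ?V then Im (gram ?I x $ k $ i) else 0))" for k i
    by (rule gamma_Im_gram) blast
  then obtain Q where Q: "\<And>k i. Q k i \<in> Herm2"
    "\<And>k i x. gamma ?I (Q k i) x = (if x \<in> ?V then Im (gram ?I x $ k $ i) else 0)"
    by metis
  let ?g = "gamma ?I"
  \<comment> \<open>The coefficients are complex but the span is real: \<open>F q\<close> is the
    real part of coefficient times product of Gram entries, written out in real and imaginary
    parts.\<close>
  define F where "F q = (case q of (i, k, j, l) \<Rightarrow>
      Re (\<kappa> q) *\<^sub>R (?g (P k i) * ?g (P l j) - ?g (Q k i) * ?g (Q l j)) -
      Im (\<kappa> q) *\<^sub>R (?g (P k i) * ?g (Q l j) + ?g (Q k i) * ?g (P l j)))" for q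
  have FG: "F q \<in> G4 ?I" for q
  proof -
    have "?g B * ?g C \<in> G4 ?I" if "B \<in> Herm2" "C \<in> Herm2" for B C
      unfolding G4_def using that by (intro span_base) blast
    then show ?thesis
      unfolding F_def G4_def
      by (cases q) (simp only: prod.case, intro span_diff span_add span_scale; simp only: P Q)
  qed
  have F: "F q x = (if x \<in> ?V then Re (\<kappa> q * (case q of (i, k, j, l) \<Rightarrow> gram ?I x $ k $ i * gram ?I x $ l $ j)) else 0)" for q x
    by (cases q) (simp add: F_def P Q scaleR_fun_def algebra_simps)
  have "f = (1 / 2) *\<^sub>R (\<Sum>q\<in>UNIV. F q)"
  proof
    fix x
    show "f x = ((1 / 2) *\<^sub>R (\<Sum>q\<in>UNIV. F q)) x"
    proof (cases "x \<in> ?V")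
      case True
      have "2 * f x = Re (gram_form ?I \<kappa> x)" by (simp flip: \<kappa>[OF True])
      also have "\<dots> = (\<Sum>q\<in>UNIV. F q x)" using True by (simp only: gram_form_def Re_sum F if_True)
      finally show ?thesis by (simp add: scaleR_fun_def sum_fun_apply)
    next
      case False
      have "f x = 0" using Sym4_outside[of f ?I x] f False by (simp add: Sym4_inv_def)
      with False show ?thesis by (simp add: scaleR_fun_def sum_fun_apply F)
    qed
  qed
  also have "\<dots> \<in> G4 ?I"
    using FG unfolding G4_def by (intro span_scale span_sum)
  finally show "f \<in> G4 ?I" .
qed

section \<open>Products of Gram forms are invariant quartics\<close>

text \<open>The factor \<open>z\<close> covers real parts (\<open>1\<close>), imaginary parts
  (\<open>- \<i>\<close>) and coordinates multiplied by a matrix entry at once.\<close>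

lemma coordinate_in_V_dual:
  "(\<lambda>x. if x \<in> V_space I then Re (z * component x i a) else 0) \<in> V_dual I"
proof -
  have "component (x + y) i a = component x i a + component y i a"
    "component (t *\<^sub>R x) i a = t *\<^sub>R component x i a" for x y :: "'a pairvec" and t
    by (simp_all add: component_def scaleR_fun_def)
  then show ?thesis
    using subspace_add[OF subspace_V_space[of I]] subspace_scale[OF subspace_V_space[of I]]
    by (simp add: V_dual_def real_linear_on_def distrib_left)
qed

lemma gamma_in_span_products:
  "gamma I B \<in> span {f * g | f g. f \<in> V_dual I \<and> g \<in> V_dual I}"
proof -
  define L where "L z i a = (\<lambda>x. if x \<in> V_space I then Re (z * component x i a) else 0)" for z i a
  have L: "L z i a * L w j b \<in> span {f * g | f g. f \<in> V_dual I \<and> g \<in> V_dual I}" for z i a w j b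
  proof -
    have "L z i a \<in> V_dual I" for z i a unfolding L_def by (rule coordinate_in_V_dual)
    then show ?thesis by (intro span_base CollectI exI conjI) (rule refl)
  qed
  \<comment> \<open>Termwise this is \<open>Re (cnj y * w) = Re y * Re w + Im y * Im w\<close>, with
    \<open>Im\<close> written as the real part after multiplication by
    \<open>- \<i>\<close>.\<close>
  have "gamma I B = (\<Sum>p\<in>UNIV. \<Sum>q\<in>UNIV. \<Sum>a\<in>I.
      L 1 q a * L (B $ p $ q) p a + L (- \<i>) q a * L (- \<i> * B $ p $ q) p a)"
  proof
    fix x
    show "gamma I B x = (\<Sum>p\<in>UNIV. \<Sum>q\<in>UNIV. \<Sum>a\<in>I.
        L 1 q a * L (B $ p $ q) p a + L (- \<i>) q a * L (- \<i> * B $ p $ q) p a) x"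
    proof (cases "x \<in> V_space I")
      case True
      have "Re (B $ p $ q * (cnj (component x q a) * component x p a)) =
          L 1 q a x * L (B $ p $ q) p a x + L (- \<i>) q a x * L (- \<i> * B $ p $ q) p a x" for p q a
        using True by (simp add: L_def algebra_simps)
      moreover have "Re (trace (B ** gram I x)) = (\<Sum>p\<in>UNIV. \<Sum>q\<in>UNIV. \<Sum>a\<in>I.
          Re (B $ p $ q * (cnj (component x q a) * component x p a)))"
        unfolding trace_def matrix_matrix_mult_def gram_def herm_def vec_lambda_beta sum_distrib_left Re_sum ..
      ultimately show ?thesis
        using True by (simp only: gamma_def if_True sum_fun_apply plus_fun_apply times_fun_apply)
    next
      case False
      then have "L z i a x = 0" for z i a by (simp add: L_def)
      with False show ?thesis
        by (simp only: gamma_def if_False sum_fun_apply plus_fun_apply times_fun_apply) simp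
    qed
  qed
  also have "\<dots> \<in> span {f * g | f g. f \<in> V_dual I \<and> g \<in> V_dual I}"
    by (intro span_sum span_add L)
  finally show ?thesis .
qed

text \<open>Span induction in each factor, by bilinearity of the product.\<close>

lemma product_in_Sym4:
  assumes "f \<in> span {f * g | f g. f \<in> V_dual I \<and> g \<in> V_dual I}"
    and "h \<in> span {f * g | f g. f \<in> V_dual I \<and> g \<in> V_dual I}"
  shows "f * h \<in> Sym4 I"
proof -
  let ?P = "{f * g | f g. f \<in> V_dual I \<and> g \<in> V_dual I}"
  have scale: "(t *\<^sub>R f) * h = t *\<^sub>R (f * h)" "h * (t *\<^sub>R f) = t *\<^sub>R (h * f)" for t and f h :: "'a pairvec \<Rightarrow> real"
    by (simp_all add: fun_eq_iff scaleR_fun_def)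
  have sub: "subspace (Sym4 I)" unfolding Sym4_def by (rule subspace_span)
  have base: "f * h \<in> Sym4 I" if "f \<in> ?P" "h \<in> ?P" for f h
  proof -
    obtain f1 f2 where f: "f = f1 * f2" "f1 \<in> V_dual I" "f2 \<in> V_dual I"
      using \<open>f \<in> ?P\<close> by blast
    obtain h1 h2 where h: "h = h1 * h2" "h1 \<in> V_dual I" "h2 \<in> V_dual I"
      using \<open>h \<in> ?P\<close> by blast
    have "f * h = f1 * f2 * h1 * h2" by (simp only: f(1) h(1) mult.assoc)
    then show ?thesis
      using f h unfolding Sym4_def by (intro span_base) blast
  qed
  have "f * h \<in> Sym4 I" if h: "h \<in> ?P" for h
    using assms(1)
  proof (rule span_induct)
    show "f * h \<in> Sym4 I" if "f \<in> ?P" for f by (rule base[OF that h])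
    show "subspace {f. f * h \<in> Sym4 I}"
      using sub by (simp add: subspace_def scale distrib_right)
  qed
  moreover have "subspace {h. f * h \<in> Sym4 I}"
    using sub by (simp add: subspace_def scale distrib_left)
  ultimately show ?thesis
    using span_induct[OF assms(2), of "\<lambda>h. f * h \<in> Sym4 I"] by blast
qed

lemma G4_subset_Sym4_inv: "G4 (bits r) \<subseteq> Sym4_inv (bits r) (Cliff r)"
proof -
  let ?I = "bits r"
  have "subspace (Sym4 ?I)" unfolding Sym4_def by (rule subspace_span)
  then have "subspace (Sym4_inv ?I (Cliff r))"
    unfolding subspace_def Sym4_inv_def mem_Collect_eq
    by (intro conjI ballI allI) (simp_all add: scaleR_fun_def)
  moreover have "gamma ?I B * gamma ?I C \<in> Sym4_inv ?I (Cliff r)" for B C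
  proof -
    have "gamma ?I B * gamma ?I C \<in> Sym4 ?I"
      by (intro product_in_Sym4 gamma_in_span_products)
    moreover have "gamma ?I D (map_prod g g x) = gamma ?I D x" if "g \<in> Cliff r" "x \<in> V_space ?I" for D g x
      using that Cliff_in_V_space[OF that] by (simp add: gamma_def gram_Cliff)
    ultimately show ?thesis by (simp add: Sym4_inv_def)
  qed
  ultimately show ?thesis
    unfolding G4_def by (intro span_minimal) auto
qed

text \<open>Since the invariants equal \<open>G4 (bits r)\<close>, any two of them are related, and
  the class of each is the whole space; \<open>0\<close> shows that a class exists.\<close>

lemma P4_Cliff:
  assumes r: "r \<ge> 1"
  shows "P4 (bits r) (Cliff r) = {G4 (bits r)}"
proof -
  let ?G = "G4 (bits r)" and ?S = "Sym4_inv (bits r) (Cliff r)"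
  let ?R = "{(f, h). f \<in> ?S \<and> h \<in> ?S \<and> f - h \<in> ?G}"
  have S: "?S = ?G" using Sym4_inv_subset_G4[OF r] G4_subset_Sym4_inv by blast
  have "?R `` {f} = ?G" if "f \<in> ?S" for f
    using that unfolding S by (auto simp: G4_def intro: span_diff)
  moreover have "0 \<in> ?S" unfolding S G4_def by (rule span_zero)
  ultimately show ?thesis
    unfolding P4_def quotient_def by blast
qed

section \<open>Dimensions\<close>

text \<open>The real basis is formed by \<open>ket a 1\<close> and \<open>ket a \<i>\<close>.
  Evaluating a relation at \<open>a\<close> leaves one complex number whose real and imaginary parts
  are the two coefficients there.\<close>

lemma dim_hspace:
  assumes I: "finite I"
  shows "dim (hspace I) = 2 * card I"
proof -
  let ?b = "\<lambda>(a, z). ket a z :: 'a \<Rightarrow> complex" and ?J = "I \<times> {1, \<i>}"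
  let ?B = "?b ` ?J"
  have inj: "inj_on ?b ?J"
  proof (rule inj_onI)
    fix p q assume p: "p \<in> ?J" and q: "q \<in> ?J" and eq: "?b p = ?b q"
    obtain a z b w where pq: "p = (a, z)" "q = (b, w)" by (cases p, cases q) blast
    have "z \<noteq> 0" using p pq by auto
    moreover have "ket a z a = ket b w a" using eq by (simp only: pq prod.case)
    ultimately show "p = q" by (simp add: pq ket_def split: if_splits)
  qed
  have "independent ?B"
  proof (rule independent_if_scalars_zero)
    show "finite ?B" using I by simp
    fix u x assume s: "(\<Sum>x\<in>?B. u x *\<^sub>R x) = 0" and x: "x \<in> ?B"
    then obtain a where a: "a \<in> I" "x = ket a 1 \<or> x = ket a \<i>" by auto
    have "(\<Sum>x\<in>?B. u x *\<^sub>R x) = (\<Sum>c\<in>I. \<Sum>z\<in>{1, \<i>}. u (ket c z) *\<^sub>R ket c z)"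
      unfolding sum.reindex[OF inj] sum.cartesian_product
      by (rule sum.cong[OF refl]) (simp add: split_beta)
    then have "(\<Sum>c\<in>I. \<Sum>z\<in>{1, \<i>}. u (ket c z) *\<^sub>R ket c z) a = 0"
      using s by (simp only: zero_fun_apply)
    then have "(\<Sum>c\<in>I. \<Sum>z\<in>{1, \<i>}. u (ket c z) *\<^sub>R ket c z a) = 0"
      by (simp only: sum_fun_apply scaleR_fun_def)
    moreover have "(\<Sum>c\<in>I. \<Sum>z\<in>{1, \<i>}. u (ket c z) *\<^sub>R ket c z a) =
        (\<Sum>c\<in>I. if c = a then of_real (u (ket a 1)) + \<i> * of_real (u (ket a \<i>)) else 0)"
      by (rule sum.cong[OF refl]) (simp add: ket_def scaleR_conv_of_real complex_eq_iff)
    ultimately have "complex_of_real (u (ket a 1)) + \<i> * of_real (u (ket a \<i>)) = 0"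
      using I a(1) by simp
    then have "u (ket a 1) = 0" "u (ket a \<i>) = 0" by (simp_all add: complex_eq_iff)
    with a(2) show "u x = 0" by auto
  qed
  moreover have "span ?B = span (hspace I)"
  proof (rule antisym)
    show "span ?B \<subseteq> span (hspace I)" by (rule span_mono) auto
    have "x \<in> span ?B" if x: "x \<in> hspace I" for x
    proof -
      have "ket a z \<in> span ?B" if "a \<in> I" for a z
      proof -
        have "ket a z = Re z *\<^sub>R ket a 1 + Im z *\<^sub>R ket a \<i>"
          by (rule ext) (simp add: ket_def scaleR_fun_def complex_eq_iff)
        also have "\<dots> \<in> span ?B"
        proof (intro span_add span_scale span_base)
          show "ket a 1 \<in> ?B" by (rule image_eqI[of _ _ "(a, 1)"]) (use that in simp_all)
          show "ket a \<i> \<in> ?B" by (rule image_eqI[of _ _ "(a, \<i>)"]) (use that in simp_all)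
        qed
        finally show ?thesis .
      qed
      then have "(\<Sum>a\<in>I. ket a (x a)) \<in> span ?B" by (intro span_sum)
      then show ?thesis using sum_ket[OF I x] by simp
    qed
    then show "span (hspace I) \<subseteq> span ?B" by (intro span_minimal subspace_span subsetI)
  qed
  ultimately have "dim (hspace I) = card ?B" by (intro dim_eq_card)
  also have "\<dots> = 2 * card I" by (simp add: card_image[OF inj] card_cartesian_product complex_eq_iff)
  finally show ?thesis .
qed

lemma dim_hspace_bits: "dim (hspace (bits r)) = 2 ^ (r + 1)"
  by (simp add: dim_hspace card_bits)

lemma dim_E_C: "dim E_C = 3"
proof -
  define m :: "complex \<Rightarrow> complex \<Rightarrow> complex \<Rightarrow> complex \<Rightarrow> complex^2^2"
    where "m a b c d = vector [vector [a, b], vector [c, d]]" for a b c d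
  have m [simp]: "m a b c d $ 1 $ 1 = a" "m a b c d $ 1 $ 2 = b" "m a b c d $ 2 $ 1 = c" "m a b c d $ 2 $ 2 = d"
    for a b c d by (simp_all add: m_def)
  have eq: "A = B \<longleftrightarrow> A $ 1 $ 1 = B $ 1 $ 1 \<and> A $ 1 $ 2 = B $ 1 $ 2 \<and> A $ 2 $ 1 = B $ 2 $ 1 \<and> A $ 2 $ 2 = B $ 2 $ 2"
    for A B :: "complex^2^2" by (auto simp: vec_eq_iff forall_2)
  \<comment> \<open>The Pauli matrices. The entry \<open>- \<i>\<close> in the upper right corner of
    \<open>?Y\<close> causes the minus sign before the imaginary part in the expansion of
    \<open>A\<close>.\<close>
  let ?X = "m 0 1 1 0" and ?Y = "m 0 (- \<i>) \<i> 0" and ?Z = "m 1 0 0 (- 1)"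
  have dist: "?X \<noteq> ?Y" "?X \<noteq> ?Z" "?Y \<noteq> ?Z" by (simp_all add: eq complex_eq_iff)
  have "independent {?X, ?Y, ?Z}"
  proof (rule independent_if_scalars_zero)
    fix u x assume s: "(\<Sum>x\<in>{?X, ?Y, ?Z}. u x *\<^sub>R x) = 0" and x: "x \<in> {?X, ?Y, ?Z}"
    then have "u ?X *\<^sub>R ?X + u ?Y *\<^sub>R ?Y + u ?Z *\<^sub>R ?Z = 0" using dist by (simp add: add.assoc)
    then have "u ?X = 0" "u ?Y = 0" "u ?Z = 0" by (simp_all add: eq complex_eq_iff)
    with x show "u x = 0" by auto
  qed simp
  moreover have "span {?X, ?Y, ?Z} = span E_C"
  proof (rule antisym)
    have "?X \<in> E_C" "?Y \<in> E_C" "?Z \<in> E_C"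
      by (simp_all add: E_C_def Herm2_def forall_2 trace_def sum_2)
    then show "span {?X, ?Y, ?Z} \<subseteq> span E_C" by (intro span_mono) blast
    have "A \<in> span {?X, ?Y, ?Z}" if A: "A \<in> E_C" for A
    proof -
      have "A = Re (A $ 1 $ 2) *\<^sub>R ?X + (- Im (A $ 1 $ 2)) *\<^sub>R ?Y + Re (A $ 1 $ 1) *\<^sub>R ?Z"
      proof -
        have "A $ 1 $ 1 = cnj (A $ 1 $ 1)" "A $ 2 $ 1 = cnj (A $ 1 $ 2)"
          using A unfolding E_C_def Herm2_def by blast+
        moreover have "A $ 1 $ 1 + A $ 2 $ 2 = 0"
          using A by (simp add: E_C_def trace_def sum_2)
        ultimately have "Im (A $ 1 $ 1) = 0" "Re (A $ 2 $ 1) = Re (A $ 1 $ 2)"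
          "Im (A $ 2 $ 1) = - Im (A $ 1 $ 2)" "Re (A $ 2 $ 2) = - Re (A $ 1 $ 1)" "Im (A $ 2 $ 2) = 0"
          unfolding complex_eq_iff by auto
        then show ?thesis by (simp add: eq complex_eq_iff)
      qed
      also have "\<dots> \<in> span {?X, ?Y, ?Z}"
        by (intro span_add span_scale span_base) auto
      finally show ?thesis .
    qed
    then show "span E_C \<subseteq> span {?X, ?Y, ?Z}" by (intro span_minimal subspace_span subsetI)
  qed
  ultimately have "dim E_C = card {?X, ?Y, ?Z}" by (intro dim_eq_card)
  then show ?thesis using dist by simp
qed

theorem corollary3p9:
  shows "(\<forall>r\<ge>1. End_G (bits r) (Cliff r) = complex_scalars (bits r) \<and>
                 P4 (bits r) (Cliff r) = {G4 (bits r)}) \<and>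
         (\<forall>r\<ge>1. dim (hspace (bits r)) = 2 ^ (r + 1)) \<and>
         filterlim (\<lambda>r. dim (hspace (bits r))) at_top sequentially \<and>
         dim E_C = 3 \<and>
         (\<forall>N. \<exists>r\<ge>1. N \<le> dim (hspace (bits r)) \<and>
                 End_G (bits r) (Cliff r) = complex_scalars (bits r) \<and>
                 P4 (bits r) (Cliff r) = {G4 (bits r)})"
proof -
  \<comment> \<open>The crude bound by \<open>2 ^ (n + 1)\<close> suffices for the limit and for the
    witness \<open>r = N + 1\<close>, which is positive even when \<open>N = 0\<close>.\<close>
  have large: "n \<le> dim (hspace (bits n))" for n
    using less_exp[of "n + 1"] by (simp add: dim_hspace_bits)
  have "filterlim (\<lambda>r. dim (hspace (bits r))) at_top sequentially"
    by (rule filterlim_at_top_mono[OF filterlim_ident]) (simp add: large)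
  moreover have "N \<le> dim (hspace (bits (N + 1)))" for N
    using large[of "N + 1"] by simp
  moreover have "(1::nat) \<le> N + 1" for N by simp
  ultimately show ?thesis
    using End_G_Cliff P4_Cliff dim_hspace_bits dim_E_C by blast
qed

end
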